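(* Let $d,n,d_1,\ldots,d_n$ be positive integers with $n>d$, and let $0<\varepsilon<0.3$. Let $\mathcal{F}=\{X_1,\ldots,X_n\}$ with $X_i\in\mathbb{R}^{d\times d_i}$, $i\in[n]$, be an $\varepsilon$-nearly equal-norm Parseval matrix frame. Then there exists an equal-norm Parseval matrix frame $\mathcal{W}=\{W_1,\ldots,W_n\}$ with $W_i\in\mathbb{R}^{d\times d_i}$, $i\in[n]$, such that $$\operatorname{dist}^2(\mathcal{F},\mathcal{W})\le 46\,\varepsilon d^2.$$
   Context: $[n]=\{1,\ldots,n\}$, $\|\cdot\|_F$ is the Frobenius norm, and $\preceq$ is the Loewner order on symmetric matrices. A tuple $\mathcal{F}=\{X_1,\ldots,X_n\}$ with $X_i\in\mathbb{R}^{d\times d_i}$ is an equal-norm Parseval matrix frame if $\sum_{i=1}^nX_iX_i^T=I_d$ and $\|X_i\|_F^2=\frac dn$ for all $i\in[n]$. A tuple $\mathcal{F}=\{X_1,\ldots,X_n\}$ with $X_i\in\mathbb{R}^{d\times d_i}$ and $\sum_i X_iX_i^T$ positive definite is an $\varepsilon$-nearly equal-norm Parseval matrix frame ($\varepsilon>0$) if $(1-\varepsilon)I_d\preceq\sum_{i=1}^nX_iX_i^T\preceq(1+\varepsilon)I_d$ and $(1-\varepsilon)\frac dn\le\|X_i\|_F^2\le(1+\varepsilon)\frac dn$ for all $i\in[n]$. For $\mathcal{F}=\{X_1,\ldots,X_n\}$ and $\mathcal{G}=\{Y_1,\ldots,Y_n\}$ with $X_i,Y_i\in\mathbb{R}^{d\times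 d_i}$, $\operatorname{dist}^2(\mathcal{F},\mathcal{G})=\sum_{i=1}^n\|X_i-Y_i\|_F^2$. *)

theory Defs
  imports Complex_Main "Jordan_Normal_Form.Matrix"
begin

definition frob_norm :: "real mat \<Rightarrow> real" where
  "frob_norm A = sqrt (\<Sum>i<dim_row A. \<Sum>j<dim_col A. (A $$ (i, j))\<^sup>2)"

definition symmetric_mat :: "nat \<Rightarrow> real mat \<Rightarrow> bool" where
  "symmetric_mat d A \<longleftrightarrow> A \<in> carrier_mat d d \<and> transpose_mat A = A"

definition pos_semidef_mat :: "nat \<Rightarrow> real mat \<Rightarrow> bool" where
  "pos_semidef_mat d A \<longleftrightarrow> symmetric_mat d A \<and>
    (\<forall>v \<in> carrier_vec d. 0 \<le> v \<bullet> (A *\<^sub>v v))"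

definition pos_def_mat :: "nat \<Rightarrow> real mat \<Rightarrow> bool" where
  "pos_def_mat d A \<longleftrightarrow> symmetric_mat d A \<and>
    (\<forall>v \<in> carrier_vec d. v \<noteq> 0\<^sub>v d \<longrightarrow> 0 < v \<bullet> (A *\<^sub>v v))"

definition loewner_le :: "nat \<Rightarrow> real mat \<Rightarrow> real mat \<Rightarrow> bool" where
  "loewner_le d A B \<longleftrightarrow> symmetric_mat d A \<and> symmetric_mat d B \<and> pos_semidef_mat d (B - A)"

(* A tuple of n matrices is a function on nat of which only the values at 1, ..., n
   matter; its k-th member has d rows and m k columns. *)

definition mat_tuple :: "nat \<Rightarrow> nat \<Rightarrow> (nat \<Rightarrow> nat) \<Rightarrow> (nat \<Rightarrow> real mat) \<Rightarrow> bool" where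
  "mat_tuple d n m X \<longleftrightarrow> (\<forall>k \<in> {1..n}. X k \<in> carrier_mat d (m k))"

(* The type of matrices of all dimensions has no zero element, so the sum over k
   of X k times its transpose is taken entry by entry. *)
definition frame_operator :: "nat \<Rightarrow> nat \<Rightarrow> (nat \<Rightarrow> real mat) \<Rightarrow> real mat" where
  "frame_operator d n X =
    mat d d (\<lambda>(i, j). \<Sum>k = 1..n. (X k * transpose_mat (X k)) $$ (i, j))"

definition equal_norm_parseval_frame ::
    "nat \<Rightarrow> nat \<Rightarrow> (nat \<Rightarrow> nat) \<Rightarrow> (nat \<Rightarrow> real mat) \<Rightarrow> bool" where
  "equal_norm_parseval_frame d n m X \<longleftrightarrow>
    mat_tuple d n m X \<and>
    frame_operator d n X = 1\<^sub>m d \<and>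
    (\<forall>k \<in> {1..n}. (frob_norm (X k))\<^sup>2 = real d / real n)"

definition nearly_equal_norm_parseval_frame ::
    "real \<Rightarrow> nat \<Rightarrow> nat \<Rightarrow> (nat \<Rightarrow> nat) \<Rightarrow> (nat \<Rightarrow> real mat) \<Rightarrow> bool" where
  "nearly_equal_norm_parseval_frame \<epsilon> d n m X \<longleftrightarrow>
    0 < \<epsilon> \<and>
    mat_tuple d n m X \<and>
    pos_def_mat d (frame_operator d n X) \<and>
    loewner_le d ((1 - \<epsilon>) \<cdot>\<^sub>m 1\<^sub>m d) (frame_operator d n X) \<and>
    loewner_le d (frame_operator d n X) ((1 + \<epsilon>) \<cdot>\<^sub>m 1\<^sub>m d) \<and>
    (\<forall>k \<in> {1..n}. (1 - \<epsilon>) * (real d / real n) \<le> (frob_norm (X k))\<^sup>2 \<and>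
      (frob_norm (X k))\<^sup>2 \<le> (1 + \<epsilon>) * (real d / real n))"

definition frame_dist_sq :: "nat \<Rightarrow> (nat \<Rightarrow> real mat) \<Rightarrow> (nat \<Rightarrow> real mat) \<Rightarrow> real" where
  "frame_dist_sq n X Y = (\<Sum>k = 1..n. (frob_norm (X k - Y k))\<^sup>2)"

end

theory Submission
  imports Defs "Jordan_Normal_Form.Determinant"
begin

text \<open>
  After a small perturbation and a normalisation, the columns \<open>z\<close> of the frame have blocks of squared
  norm \<open>d / n\<close> exactly, frame operator at least \<open>1 - 4 \<epsilon>\<close>, and the first columns of any \<open>d\<close>
  cyclically consecutive blocks are linearly independent. Hadamard-type bounds for these \<open>n\<close> bases,
  each block being used \<open>d\<close> times, show that
  \<open>\<Sum>i. ln \<parallel>A Z\<^sub>i\<parallel>\<^sup>2 - (n / d) ln (det A)\<^sup>2\<close> is bounded below over all invertible \<open>A\<close>.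
  Along a minimising sequence the rescaled blocks \<open>A Z\<^sub>i / \<parallel>A Z\<^sub>i\<parallel>\<close> converge, after passing to a
  subsequence, to a Parseval frame, since otherwise one more scaling step would go below the infimum.

  By the spectral theorem \<open>A\<close> may be taken to be a positive decreasing diagonal matrix after a rotation.
  Such a scaling moves the mass of each block towards the first coordinates, so that all partial sums
  of the row masses increase. Over all blocks the first \<open>k\<close> rows gain at most \<open>4 k \<epsilon>\<close>, and summing this
  over \<open>k < d\<close> bounds the squared distance by \<open>4 d (d - 1) \<epsilon>\<close>.
\<close>

section \<open>Inner products, orthonormal systems and determinants\<close>

text \<open>Vectors are functions on the naturals of which only the first \<open>d\<close> values
  count. A family \<open>v a j\<close> of \<open>d\<close> vectors is read as the square matrix with
  rows \<open>v a\<close>; thus \<open>orthonormal\<close> describes an orthogonal matrix and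
  \<open>fdet\<close> the determinant.\<close>

definition ip :: "nat \<Rightarrow> (nat \<Rightarrow> real) \<Rightarrow> (nat \<Rightarrow> real) \<Rightarrow> real" where
  "ip d x y = (\<Sum>j<d. x j * y j)"

definition orthonormal :: "nat \<Rightarrow> (nat \<Rightarrow> nat \<Rightarrow> real) \<Rightarrow> bool" where
  "orthonormal d v \<longleftrightarrow> (\<forall>a<d. \<forall>b<d. ip d (v a) (v b) = (if a = b then 1 else 0))"

definition fdet :: "nat \<Rightarrow> (nat \<Rightarrow> nat \<Rightarrow> real) \<Rightarrow> real" where
  "fdet d a = det (mat d d (\<lambda>(i, j). a i j))"

definition bform :: "nat \<Rightarrow> (nat \<Rightarrow> nat \<Rightarrow> real) \<Rightarrow> (nat \<Rightarrow> real) \<Rightarrow> (nat \<Rightarrow> real) \<Rightarrow> real" where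
  "bform d M x y = (\<Sum>i<d. \<Sum>j<d. x i * M i j * y j)"

section \<open>Linearity of the inner product\<close>

lemma ip_commute: "ip d x y = ip d y x"
  by (simp add: ip_def mult.commute)

lemma ip_cong: "(\<And>j. j < d \<Longrightarrow> x j = x' j) \<Longrightarrow> (\<And>j. j < d \<Longrightarrow> y j = y' j) \<Longrightarrow> ip d x y = ip d x' y'"
  by (simp add: ip_def)

lemma ip_scale_left: "ip d (\<lambda>j. c * x j) y = c * ip d x y"
  by (simp add: ip_def sum_distrib_left mult.assoc)

lemma ip_add_left: "ip d (\<lambda>j. x j + x' j) y = ip d x y + ip d x' y"
  by (simp add: ip_def sum.distrib algebra_simps)

lemma ip_sum_left: "ip d (\<lambda>j. \<Sum>k\<in>K. f k j) y = (\<Sum>k\<in>K. ip d (f k) y)"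
  unfolding ip_def by (subst sum.swap) (simp add: sum_distrib_right)

lemma ip_self: "ip d x x = (\<Sum>j<d. (x j)\<^sup>2)"
  by (simp add: ip_def power2_eq_square)

lemma ip_self_nonneg: "0 \<le> ip d x x"
  by (simp add: ip_self sum_nonneg)

lemma orthonormal_ip:
  "orthonormal d v \<Longrightarrow> a < d \<Longrightarrow> b < d \<Longrightarrow> ip d (v a) (v b) = (if a = b then 1 else 0)"
  by (simp add: orthonormal_def)

section \<open>Gram determinants and orthonormal bases\<close>

lemma fdet_ip: "fdet d (\<lambda>i k. ip d (a i) (b k)) = fdet d a * fdet d b"
proof -
  let ?A = "mat d d (\<lambda>(i, j). a i j)" and ?B = "mat d d (\<lambda>(i, j). b i j)"
  have "mat d d (\<lambda>(i, k). ip d (a i) (b k)) = ?A * transpose_mat ?B"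
    by (rule eq_matI) (auto simp: ip_def scalar_prod_def atLeast0LessThan)
  then show ?thesis
    by (simp add: fdet_def det_mult[of _ d] det_transpose[of _ d])
qed

lemma fdet_transpose: "fdet d (\<lambda>i j. a j i) = fdet d a"
proof -
  have "mat d d (\<lambda>(i, j). a j i) = transpose_mat (mat d d (\<lambda>(i, j). a i j))"
    by (rule eq_matI) auto
  then show ?thesis
    by (simp add: fdet_def det_transpose[of _ d])
qed

lemma fdet_cong: "(\<And>i j. i < d \<Longrightarrow> j < d \<Longrightarrow> a i j = b i j) \<Longrightarrow> fdet d a = fdet d b"
  unfolding fdet_def by (rule arg_cong[of _ _ det], rule eq_matI) auto

lemma fdet_diagonal:
  assumes "\<And>i k. i < d \<Longrightarrow> k < d \<Longrightarrow> i \<noteq> k \<Longrightarrow> a i k = 0"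
  shows "fdet d a = (\<Prod>i<d. a i i)"
proof -
  have "fdet d a = prod_list (diag_mat (mat d d (\<lambda>(i, j). a i j)))"
    unfolding fdet_def by (rule det_lower_triangular[of d]) (use assms in auto)
  then show ?thesis
    by (simp add: prod_list_diag_prod atLeast0LessThan)
qed

lemma fdet_squared_orthogonal_rows:
  assumes "\<And>i k. i < d \<Longrightarrow> k < d \<Longrightarrow> i \<noteq> k \<Longrightarrow> ip d (a i) (a k) = 0"
  shows "(fdet d a)\<^sup>2 = (\<Prod>i<d. ip d (a i) (a i))"
  unfolding power2_eq_square fdet_ip[symmetric] by (rule fdet_diagonal) (rule assms)

lemma orthonormal_fdet_squared: "orthonormal d v \<Longrightarrow> (fdet d v)\<^sup>2 = 1"
  by (subst fdet_squared_orthogonal_rows) (auto simp: orthonormal_ip)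

text \<open>A one-sided inverse of a square matrix is two-sided, so orthonormal rows force
  orthonormal columns.\<close>

lemma orthonormal_transpose:
  assumes "orthonormal d v"
  shows "orthonormal d (\<lambda>j a. v a j)"
proof -
  let ?V = "mat d d (\<lambda>(i, j). v i j)"
  have "?V * transpose_mat ?V = 1\<^sub>m d"
    using assms by (intro eq_matI) (auto simp: orthonormal_def ip_def scalar_prod_def atLeast0LessThan)
  then have eq: "transpose_mat ?V * ?V = 1\<^sub>m d"
    by (rule mat_mult_left_right_inverse[rotated 2]) auto
  show ?thesis
    unfolding orthonormal_def
  proof (intro allI impI)
    fix a b assume "a < d" "b < d"
    then have "ip d (\<lambda>i. v i a) (\<lambda>i. v i b) = (transpose_mat ?V * ?V) $$ (a, b)"
      by (simp add: ip_def scalar_prod_def atLeast0LessThan)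
    with \<open>a < d\<close> \<open>b < d\<close> show "ip d (\<lambda>i. v i a) (\<lambda>i. v i b) = (if a = b then 1 else 0)"
      by (simp add: eq)
  qed
qed

lemma orthonormal_expansion:
  assumes "orthonormal d v" "p < d"
  shows "(\<Sum>a<d. ip d (v a) x * v a p) = x p"
proof -
  have "(\<Sum>a<d. ip d (v a) x * v a p) = (\<Sum>q<d. \<Sum>a<d. v a q * x q * v a p)"
    unfolding ip_def sum_distrib_right by (rule sum.swap)
  also have "\<dots> = (\<Sum>q<d. x q * ip d (\<lambda>a. v a q) (\<lambda>a. v a p))"
    by (simp add: ip_def sum_distrib_left algebra_simps)
  also have "\<dots> = (\<Sum>q<d. if q = p then x q else 0)"
    using assms(2) orthonormal_ip[OF orthonormal_transpose[OF assms(1)]] by (intro sum.cong) auto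
  finally show ?thesis
    using assms(2) by simp
qed

lemma parseval:
  assumes "orthonormal d v"
  shows "(\<Sum>a<d. ip d (v a) x * ip d (v a) y) = ip d x y"
proof -
  have "(\<Sum>a<d. ip d (v a) x * ip d (v a) y) = ip d (\<lambda>p. \<Sum>a<d. ip d (v a) x * v a p) y"
    by (simp add: ip_sum_left ip_scale_left)
  also have "\<dots> = ip d x y"
    by (rule ip_cong) (auto simp: orthonormal_expansion[OF assms])
  finally show ?thesis .
qed

lemma parseval_synthesis:
  assumes "orthonormal d v"
  shows "ip d (\<lambda>p. \<Sum>a<d. x a * v a p) (\<lambda>p. \<Sum>a<d. y a * v a p) = ip d x y"
  using parseval[OF orthonormal_transpose[OF assms], of x y]
  by (simp add: ip_def mult.commute)

section \<open>Size and non-vanishing of determinants\<close>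

lemma abs_fdet_le: "\<bar>fdet d a\<bar> \<le> fact d * (\<Prod>k<d. sqrt (ip d (a k) (a k)))"
proof -
  let ?A = "mat d d (\<lambda>(i, j). a i j)" and ?P = "{p. p permutes {0..<d}}"
  have entry: "\<bar>a k j\<bar> \<le> sqrt (ip d (a k) (a k))" if "j < d" for k j
    using that member_le_sum[of j "{..<d}" "\<lambda>j. (a k j)\<^sup>2"]
    by (intro real_le_rsqrt) (simp add: ip_self)
  \<comment> \<open>A weak Hadamard inequality from the Leibniz expansion: each of the
    \<open>fact d\<close> terms is at most the product of the row norms. The factor
    \<open>fact d\<close> only changes the constant in the lower bound for the potential.\<close>
  have "\<bar>fdet d a\<bar> \<le> (\<Sum>p\<in>?P. \<bar>signof p * (\<Prod>i=0..<d. ?A $$ (i, p i))\<bar>)"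
    unfolding fdet_def by (subst det_def'[of _ d]) auto
  also have "\<dots> \<le> (\<Sum>p\<in>?P. \<Prod>k<d. sqrt (ip d (a k) (a k)))"
  proof (rule sum_mono)
    fix p assume "p \<in> ?P"
    then have p: "p i < d" if "i < d" for i
      using that permutes_in_image[of p "{0..<d}" i] by auto
    have "\<bar>signof p * (\<Prod>i=0..<d. ?A $$ (i, p i))\<bar> = (\<Prod>i<d. \<bar>a i (p i)\<bar>)"
      using p by (simp add: abs_mult abs_prod sign_def atLeast0LessThan)
    also have "\<dots> \<le> (\<Prod>k<d. sqrt (ip d (a k) (a k)))"
      using p entry by (intro prod_mono) auto
    finally show "\<bar>signof p * (\<Prod>i=0..<d. ?A $$ (i, p i))\<bar> \<le> (\<Prod>k<d. sqrt (ip d (a k) (a k)))" .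
  qed
  also have "\<dots> = fact d * (\<Prod>k<d. sqrt (ip d (a k) (a k)))"
    by (simp add: card_permutations[of "{0..<d}" d])
  finally show ?thesis .
qed

lemma finite_singular_pencil:
  assumes "fdet d v \<noteq> 0"
  shows "finite {t. fdet d (\<lambda>k j. x k j + t * v k j) = 0}"
proof -
  \<comment> \<open>The pencil is reversed: \<open>q\<close> is the determinant of
    \<open>v + s * x\<close> as a polynomial in \<open>s\<close>. Its value at 0 is
    \<open>fdet d v\<close>, so it is visibly non-zero, and a non-zero root \<open>t\<close> of the
    original pencil gives the root \<open>inverse t\<close> of \<open>q\<close>.\<close>
  define q where "q = det (mat d d (\<lambda>(k, j). [:v k j, x k j:]))"
  have q: "poly q s = fdet d (\<lambda>k j. v k j + s * x k j)" for s
  proof -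
    interpret comm_ring_hom "\<lambda>p. poly p s"
      by unfold_locales auto
    have "poly q s = det (map_mat (\<lambda>p. poly p s) (mat d d (\<lambda>(k, j). [:v k j, x k j:])))"
      unfolding q_def by simp
    also have "\<dots> = fdet d (\<lambda>k j. v k j + s * x k j)"
      unfolding fdet_def by (rule arg_cong[of _ _ det], rule eq_matI) auto
    finally show ?thesis .
  qed
  have "q \<noteq> 0"
    using q[of 0] assms by auto
  then have "finite {s. poly q s = 0}"
    by (rule poly_roots_finite)
  moreover have "{t. fdet d (\<lambda>k j. x k j + t * v k j) = 0} \<subseteq> insert 0 (inverse ` {s. poly q s = 0})"
  proof
    fix t assume t: "t \<in> {t. fdet d (\<lambda>k j. x k j + t * v k j) = 0}"
    show "t \<in> insert 0 (inverse ` {s. poly q s = 0})"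
    proof (cases "t = 0")
      case False
      have "mat d d (\<lambda>(k, j). x k j + t * v k j)
          = t \<cdot>\<^sub>m mat d d (\<lambda>(k, j). v k j + inverse t * x k j)"
        using False by (intro eq_matI) (auto simp: field_simps)
      then have "t ^ d * poly q (inverse t) = 0"
        using t unfolding q fdet_def by simp
      then have "inverse t \<in> {s. poly q s = 0}"
        using False by simp
      then show ?thesis
        by (metis image_eqI inverse_inverse_eq insertI2)
    qed simp
  qed
  ultimately show ?thesis
    by (meson finite_imageI finite_insert finite_subset)
qed

text \<open>A kernel vector would hold the coefficients of a non-zero polynomial of degree below
  \<open>d\<close> with \<open>d\<close> distinct roots.\<close>

lemma fdet_vandermonde_nonzero:
  assumes "inj_on s {..<d}"
  shows "fdet d (\<lambda>k j. s k ^ j) \<noteq> 0"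
proof
  let ?A = "mat d d (\<lambda>(k, j). s k ^ j)"
  assume "fdet d (\<lambda>k j. s k ^ j) = 0"
  then obtain c where c: "c \<in> carrier_vec d" "c \<noteq> 0\<^sub>v d" "?A *\<^sub>v c = 0\<^sub>v d"
    using det_0_iff_vec_prod_zero[of ?A d] by (auto simp: fdet_def)
  define p where "p = (\<Sum>j<d. monom (c $ j) j)"
  have coeff: "coeff p j = (if j < d then c $ j else 0)" for j
    by (auto simp: p_def coeff_sum)
  obtain j where j: "j < d" "c $ j \<noteq> 0"
    using c(1,2) by (metis carrier_vecD eq_vecI index_zero_vec(1) index_zero_vec(2))
  then have "p \<noteq> 0"
    using coeff[of j] by auto
  have "degree p < d"
    using j(1) coeff by (intro degree_lessI) auto
  have "poly p (s k) = 0" if "k < d" for k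
  proof -
    have "poly p (s k) = (?A *\<^sub>v c) $ k"
      using that c(1) by (simp add: p_def poly_sum poly_monom scalar_prod_def atLeast0LessThan mult.commute)
    then show ?thesis
      using that c(3) by simp
  qed
  then have "s ` {..<d} \<subseteq> {x. poly p x = 0}"
    by auto
  then have "card (s ` {..<d}) \<le> card {x. poly p x = 0}"
    by (intro card_mono poly_roots_finite \<open>p \<noteq> 0\<close>)
  then show False
    using card_poly_roots_bound[OF \<open>p \<noteq> 0\<close>] \<open>degree p < d\<close> card_image[OF assms] by simp
qed

text \<open>Bolzano-Weierstrass in finitely many coordinates: for each further coordinate a
  monotone, hence convergent, subsequence is extracted.\<close>

lemma pointwise_convergent_subseq:
  fixes f :: "nat \<Rightarrow> 'k \<Rightarrow> real"
  assumes "finite K" "\<And>n k. k \<in> K \<Longrightarrow> \<bar>f n k\<bar> \<le> C"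
  shows "\<exists>r l. strict_mono r \<and> (\<forall>k\<in>K. (\<lambda>n. f (r n) k) \<longlonglongrightarrow> l k)"
  using assms
proof (induction K rule: finite_induct)
  case empty
  show ?case
    using strict_mono_id by blast
next
  case (insert k K)
  then obtain r l where r: "strict_mono r" "\<forall>k\<in>K. (\<lambda>n. f (r n) k) \<longlonglongrightarrow> l k"
    by blast
  obtain g where g: "strict_mono g" "monoseq (\<lambda>n. f (r (g n)) k)"
    using seq_monosub[of "\<lambda>n. f (r n) k"] by blast
  have "Bseq (\<lambda>n. f (r (g n)) k)"
    using insert.prems by (intro BseqI'[where K = C]) auto
  then obtain L where L: "(\<lambda>n. f (r (g n)) k) \<longlonglongrightarrow> L"
    using Bseq_monoseq_convergent[OF _ g(2)] by (auto simp: convergent_def)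
  have "(\<lambda>n. f ((r \<circ> g) n) k') \<longlonglongrightarrow> (l(k := L)) k'" if "k' \<in> insert k K" for k'
    using that L r(2) LIMSEQ_subseq_LIMSEQ[OF _ g(1), of "\<lambda>n. f (r n) k'" "l k'"]
    by (cases "k' = k") (auto simp: o_def)
  then show ?case
    using strict_mono_o[OF r(1) g(1)] by blast
qed

section \<open>The spectral theorem\<close>

lemma bform_commute:
  assumes "\<And>i j. i < d \<Longrightarrow> j < d \<Longrightarrow> M i j = M j i"
  shows "bform d M x y = bform d M y x"
  unfolding bform_def by (subst sum.swap) (use assms in \<open>simp add: algebra_simps\<close>)

lemma bform_combination:
  "bform d M (\<lambda>j. p * x j + q * y j) (\<lambda>j. r * x j + s * y j) =
    p * r * bform d M x x + p * s * bform d M x y + q * r * bform d M y x + q * s * bform d M y y"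
  by (simp add: bform_def sum_distrib_left sum.distrib[symmetric] algebra_simps)

lemma ip_combination:
  "ip d (\<lambda>j. p * x j + q * y j) z = p * ip d x z + q * ip d y z"
  by (simp add: ip_add_left ip_scale_left)

lemma ip_combination_right:
  "ip d z (\<lambda>j. p * x j + q * y j) = p * ip d z x + q * ip d z y"
  using ip_combination by (simp add: ip_commute)

lemma unit_entry_le:
  assumes "ip d u u = 1" "j < d"
  shows "\<bar>u j\<bar> \<le> 1"
proof -
  have "(u j)\<^sup>2 \<le> ip d u u"
    unfolding ip_self using assms(2) by (intro member_le_sum) auto
  then show ?thesis
    using assms by (simp add: abs_square_le_1)
qed

lemma bform_unit_le:
  assumes "ip d u u = 1"
  shows "\<bar>bform d M u u\<bar> \<le> (\<Sum>i<d. \<Sum>j<d. \<bar>M i j\<bar>)"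
proof -
  have "\<bar>bform d M u u\<bar> \<le> (\<Sum>i<d. \<Sum>j<d. \<bar>u i * M i j * u j\<bar>)"
    unfolding bform_def by (rule order.trans[OF sum_abs]) (intro sum_mono sum_abs)
  also have "\<dots> \<le> (\<Sum>i<d. \<Sum>j<d. \<bar>M i j\<bar>)"
  proof (intro sum_mono)
    fix i j assume "i \<in> {..<d}" "j \<in> {..<d}"
    then have "\<bar>u i\<bar> * \<bar>u j\<bar> \<le> 1 * 1"
      using unit_entry_le[OF assms] by (intro mult_mono) auto
    then have "(\<bar>u i\<bar> * \<bar>u j\<bar>) * \<bar>M i j\<bar> \<le> 1 * \<bar>M i j\<bar>"
      by (intro mult_right_mono) auto
    then show "\<bar>u i * M i j * u j\<bar> \<le> \<bar>M i j\<bar>"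
      by (simp add: abs_mult ac_simps)
  qed
  finally show ?thesis .
qed

section \<open>Compactness of the set of orthonormal systems\<close>

lemma orthonormal_entry_le:
  assumes "orthonormal d v" "a < d" "j < d"
  shows "\<bar>v a j\<bar> \<le> 1"
  using assms by (intro unit_entry_le) (simp_all add: orthonormal_ip)

lemma orthonormal_standard: "orthonormal d (\<lambda>a j. if a = j then 1 else 0)"
  by (auto simp: orthonormal_def ip_def if_distrib[of "\<lambda>x. x * _"] cong: if_cong)

lemma orthonormal_limit:
  assumes "\<And>n. orthonormal d (f n)"
    and "\<And>a j. a < d \<Longrightarrow> j < d \<Longrightarrow> (\<lambda>n. f n a j) \<longlonglongrightarrow> v a j"
  shows "orthonormal d v"
  unfolding orthonormal_def
proof (intro allI impI)
  fix a b assume ab: "a < d" "b < d"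
  have "(\<lambda>n. ip d (f n a) (f n b)) \<longlonglongrightarrow> ip d (v a) (v b)"
    unfolding ip_def using ab by (intro tendsto_intros assms(2)) auto
  moreover have "(\<lambda>n. ip d (f n a) (f n b)) = (\<lambda>n. if a = b then 1 else 0)"
    using assms(1) ab by (simp add: orthonormal_ip)
  ultimately show "ip d (v a) (v b) = (if a = b then 1 else 0)"
    using LIMSEQ_unique tendsto_const by metis
qed

text \<open>Orthonormal systems have entries bounded by 1 and are closed under entrywise limits, so
  a maximising sequence has a subsequence converging to a maximiser. The hypothesis
  \<open>cont\<close> is sequential continuity for entrywise convergence.\<close>

lemma orthonormal_attains_sup:
  assumes cont: "\<And>f v. (\<And>a j. a < d \<Longrightarrow> j < d \<Longrightarrow> (\<lambda>n. f n a j) \<longlonglongrightarrow> v a j) \<Longrightarrow>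
      (\<lambda>n. obj (f n)) \<longlonglongrightarrow> (obj v :: real)"
    and bound: "\<And>v. orthonormal d v \<Longrightarrow> obj v \<le> K"
  shows "\<exists>v. orthonormal d v \<and> (\<forall>u. orthonormal d u \<longrightarrow> obj u \<le> obj v)"
proof -
  define s where "s = Sup (obj ` {v. orthonormal d v})"
  have bdd: "bdd_above (obj ` {v. orthonormal d v})"
    using bound by (intro bdd_aboveI[of _ K]) auto
  have "\<exists>v. orthonormal d v \<and> s - inverse (real (Suc n)) < obj v" for n
  proof -
    have "s - inverse (real (Suc n)) < s"
      by simp
    moreover have "obj ` {v. orthonormal d v} \<noteq> {}"
      using orthonormal_standard by auto
    ultimately show ?thesis
      using less_cSup_iff[OF _ bdd, of "s - inverse (real (Suc n))"] unfolding s_def[symmetric] by blast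
  qed
  then obtain f where f: "\<And>n. orthonormal d (f n)" "\<And>n. s - inverse (real (Suc n)) < obj (f n)"
    by metis
  obtain r l where r: "strict_mono r"
    "\<forall>k\<in>{..<d} \<times> {..<d}. (\<lambda>n. case_prod (f (r n)) k) \<longlonglongrightarrow> l k"
    using pointwise_convergent_subseq[of "{..<d} \<times> {..<d}" "\<lambda>n. case_prod (f n)" 1]
      orthonormal_entry_le[OF f(1)] by auto
  define v where "v a j = l (a, j)" for a j
  have lim: "(\<lambda>n. f (r n) a j) \<longlonglongrightarrow> v a j" if "a < d" "j < d" for a j
    using bspec[OF r(2), of "(a, j)"] that by (simp add: v_def)
  have "(\<lambda>n. s - inverse (real (Suc (r n)))) \<longlonglongrightarrow> s - 0"
    using LIMSEQ_subseq_LIMSEQ[OF LIMSEQ_inverse_real_of_nat r(1)]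
    by (intro tendsto_intros) (simp add: o_def)
  then have "s - 0 \<le> obj v"
    using cont[of "\<lambda>n. f (r n)" v, OF lim] f(2)
    by (intro LIMSEQ_le[of _ "s - 0" "\<lambda>n. obj (f (r n))"]) (auto intro: less_imp_le)
  moreover have "obj u \<le> s" if "orthonormal d u" for u
    unfolding s_def using that by (intro cSup_upper bdd) auto
  moreover have "orthonormal d v"
    using orthonormal_limit[of d "\<lambda>n. f (r n)" v] f(1) lim by blast
  ultimately show ?thesis
    by force
qed

text \<open>A maximiser of \<open>\<Sum>a. w a * M (v a) (v a)\<close> with strictly decreasing weights \<open>w\<close> diagonalises
  \<open>M\<close> with decreasing eigenvalues: rotating \<open>v a\<close> and \<open>v b\<close> by a small angle changes the sum to first
  order by a multiple of \<open>M (v a) (v b)\<close>.\<close>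

theorem spectral_sorted:
  assumes sym: "\<And>i j. i < d \<Longrightarrow> j < d \<Longrightarrow> M i j = M j i"
  shows "\<exists>v. orthonormal d v \<and>
    (\<forall>a<d. \<forall>b<d. a \<noteq> b \<longrightarrow> bform d M (v a) (v b) = 0) \<and>
    (\<forall>a b. a < b \<longrightarrow> b < d \<longrightarrow> bform d M (v b) (v b) \<le> bform d M (v a) (v a))"
proof -
  define obj where "obj v = (\<Sum>a<d. - real a * bform d M (v a) (v a))" for v
  define K where "K = (\<Sum>i<d. \<Sum>j<d. \<bar>M i j\<bar>)"
  have "\<exists>v. orthonormal d v \<and> (\<forall>u. orthonormal d u \<longrightarrow> obj u \<le> obj v)"
  proof (rule orthonormal_attains_sup)
    show "(\<lambda>n. obj (f n)) \<longlonglongrightarrow> obj v"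
      if "\<And>a j. a < d \<Longrightarrow> j < d \<Longrightarrow> (\<lambda>n. f n a j) \<longlonglongrightarrow> v a j" for f v
      unfolding obj_def bform_def by (intro tendsto_intros that) auto
    show "obj v \<le> (\<Sum>a<d. real a * K)" if "orthonormal d v" for v
      unfolding obj_def
    proof (intro sum_mono)
      fix a assume "a \<in> {..<d}"
      then have "- K \<le> bform d M (v a) (v a)"
        using bform_unit_le[of d "v a" M] orthonormal_ip[OF that, of a a] by (auto simp: K_def)
      from mult_left_mono[OF this, of "real a"]
      show "- real a * bform d M (v a) (v a) \<le> real a * K"
        by simp
    qed
  qed
  then obtain v where v: "orthonormal d v" "\<And>u. orthonormal d u \<Longrightarrow> obj u \<le> obj v"
    by blast
  have key: "2 * t * bform d M (v a) (v b) \<le> t\<^sup>2 * (bform d M (v a) (v a) - bform d M (v b) (v b))"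
    if ab: "a < b" "b < d" for a b t
  proof -
    let ?B = "\<lambda>x. bform d M x x"
    \<comment> \<open>Cosine and sine of the rotation angle whose tangent is
      \<open>t\<close>.\<close>
    define c s where "c = 1 / sqrt (1 + t\<^sup>2)" and "s = t * c"
    have c2: "c\<^sup>2 = 1 / (1 + t\<^sup>2)"
      by (simp add: c_def power_divide)
    have pos: "1 + t\<^sup>2 > 0"
      by (simp add: add_pos_nonneg)
    have cs: "c * c + s * s = 1"
      using c2 pos by (simp add: s_def power2_eq_square[symmetric] power_mult_distrib field_simps)
    define ua ub where "ua j = c * v a j + s * v b j" and "ub j = - s * v a j + c * v b j" for j
    define u where "u = v(a := ua, b := ub)"
    have "ip d ua ua = 1" "ip d ub ub = 1" "ip d ua ub = 0"
      unfolding ua_def ub_def ip_combination ip_combination_right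
      using orthonormal_ip[OF v(1)] ab cs by (simp_all add: algebra_simps)
    moreover have "ip d ua (v k) = 0" "ip d ub (v k) = 0" if "k < d" "k \<noteq> a" "k \<noteq> b" for k
      unfolding ua_def ub_def ip_combination using that orthonormal_ip[OF v(1)] ab by simp_all
    moreover have "ip d ub ua = ip d ua ub" "ip d (v k) ua = ip d ua (v k)"
      "ip d (v k) ub = ip d ub (v k)" for k
      by (rule ip_commute)+
    ultimately have "orthonormal d u"
      using orthonormal_ip[OF v(1)] ab unfolding orthonormal_def u_def by auto
    then have "obj u \<le> obj v"
      by (rule v(2))
    have split: "obj f = - real a * ?B (f a) + (- real b * ?B (f b)
        + (\<Sum>k\<in>{..<d} - {a} - {b}. - real k * ?B (f k)))" for f
      unfolding obj_def using ab
      by (subst sum.remove[of _ a], simp, simp, subst sum.remove[of _ b]) auto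
    have rest: "(\<Sum>k\<in>{..<d} - {a} - {b}. - real k * ?B (u k)) = (\<Sum>k\<in>{..<d} - {a} - {b}. - real k * ?B (v k))"
      by (intro sum.cong) (auto simp: u_def)
    have "- real a * ?B ua - real b * ?B ub \<le> - real a * ?B (v a) - real b * ?B (v b)"
      using \<open>obj u \<le> obj v\<close> ab unfolding split[of u] split[of v] rest by (simp add: u_def)
    \<comment> \<open>The rotation preserves the sum of the two diagonal values, so what one gains
      the other loses; \<open>\<delta>\<close> is this amount.\<close>
    define \<delta> where "\<delta> = 2 * (c * s) * bform d M (v a) (v b) - s * s * (?B (v a) - ?B (v b))"
    have comm: "bform d M (v b) (v a) = bform d M (v a) (v b)"
      by (rule bform_commute) (rule sym)
    have cc: "c * c = 1 - s * s"
      using cs by simp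
    have "?B ua = ?B (v a) + \<delta>" "?B ub = ?B (v b) - \<delta>"
      unfolding ua_def ub_def bform_combination comm \<delta>_def cc by (simp_all add: algebra_simps)
    with \<open>_ \<le> - real a * ?B (v a) - real b * ?B (v b)\<close> have "(real b - real a) * \<delta> \<le> 0"
      by (simp add: algebra_simps)
    then have "\<delta> \<le> 0"
      using ab by (simp add: mult_le_0_iff)
    moreover have "\<delta> = c\<^sup>2 * (2 * t * bform d M (v a) (v b) - t\<^sup>2 * (?B (v a) - ?B (v b)))"
      by (simp add: \<delta>_def s_def power2_eq_square algebra_simps)
    moreover have "c\<^sup>2 > 0"
      using c2 pos by simp
    ultimately show ?thesis
      by (simp add: mult_le_0_iff)
  qed
  have off: "bform d M (v a) (v b) = 0" if ab: "a < b" "b < d" for a b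
  proof (rule ccontr)
    let ?m = "bform d M (v a) (v b)"
    \<comment> \<open>The angle parameter \<open>?m / D\<close> has the sign of \<open>?m\<close>
      and is small enough for the first-order term to dominate: \<open>key\<close> then reads
      \<open>?m\<^sup>2 * (D + 1) \<le> 0\<close>.\<close>
    define D where "D = \<bar>bform d M (v a) (v a) - bform d M (v b) (v b)\<bar> + 1"
    assume m: "?m \<noteq> 0"
    have "2 * (?m / D) * ?m \<le> (?m / D)\<^sup>2 * (D - 1)"
      using key[OF ab, of "?m / D"] by (rule order.trans) (simp add: D_def mult_left_mono)
    moreover have "D \<ge> 1"
      by (simp add: D_def)
    ultimately have "?m\<^sup>2 * (D + 1) \<le> 0"
      by (simp add: power2_eq_square divide_simps algebra_simps split: if_splits)
    then show False
      using m \<open>D \<ge> 1\<close> by (simp add: mult_le_0_iff)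
  qed
  \<comment> \<open>Any non-zero \<open>t\<close> would do: once the mixed term vanishes,
    \<open>key\<close> compares the two diagonal values.\<close>
  have "bform d M (v b) (v b) \<le> bform d M (v a) (v a)" if "a < b" "b < d" for a b
    using key[OF that, of 1] off[OF that] by simp
  moreover have "bform d M (v a) (v b) = 0" if "a < d" "b < d" "a \<noteq> b" for a b
  proof (cases "a < b")
    case False
    then have "bform d M (v b) (v a) = 0"
      using off that by simp
    then show ?thesis
      using bform_commute[of d M "v a" "v b"] sym by simp
  qed (use off that in simp)
  ultimately show ?thesis
    using v(1) by blast
qed

section \<open>The scaling potential\<close>

lemma bform_gram:
  "bform d (\<lambda>p q. \<Sum>c\<in>C. a c p * a c q) x y = (\<Sum>c\<in>C. ip d (a c) x * ip d (a c) y)"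
proof -
  have "bform d (\<lambda>p q. \<Sum>c\<in>C. a c p * a c q) x y
      = (\<Sum>p<d. \<Sum>q<d. \<Sum>c\<in>C. (a c p * x p) * (a c q * y q))"
    by (simp add: bform_def sum_distrib_left sum_distrib_right algebra_simps)
  also have "\<dots> = (\<Sum>p<d. \<Sum>c\<in>C. \<Sum>q<d. (a c p * x p) * (a c q * y q))"
    by (intro sum.cong refl sum.swap)
  also have "\<dots> = (\<Sum>c\<in>C. \<Sum>p<d. \<Sum>q<d. (a c p * x p) * (a c q * y q))"
    by (rule sum.swap)
  finally show ?thesis
    by (simp add: ip_def sum_product)
qed

lemma ip_orthogonal_combination:
  assumes "\<And>a b. a < d \<Longrightarrow> b < d \<Longrightarrow> a \<noteq> b \<Longrightarrow> ip d (h a) (h b) = 0"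
  shows "ip d (\<lambda>p. \<Sum>a<d. c a * h a p) (\<lambda>p. \<Sum>a<d. c a * h a p) = (\<Sum>a<d. (c a)\<^sup>2 * ip d (h a) (h a))"
proof -
  have "ip d (\<lambda>p. \<Sum>a<d. c a * h a p) (\<lambda>p. \<Sum>a<d. c a * h a p)
      = (\<Sum>a<d. c a * (\<Sum>b<d. c b * ip d (h b) (h a)))"
    by (simp add: ip_sum_left ip_scale_left ip_commute[of d "h _" "\<lambda>p. \<Sum>a<d. c a * h a p"])
  also have "\<dots> = (\<Sum>a<d. c a * (\<Sum>b<d. if b = a then c a * ip d (h a) (h a) else 0))"
    using assms by (intro sum.cong refl arg_cong2[of _ _ _ _ "(*)"]) auto
  finally show ?thesis
    by (simp add: power2_eq_square mult.assoc)
qed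

text \<open>Ensures that, when the windows of cyclically consecutive blocks are summed over all
  starting points, each offset runs through every block exactly once.\<close>

lemma bij_betw_add_mod:
  fixes k n :: nat
  assumes "0 < n"
  shows "bij_betw (\<lambda>i. (i + k) mod n) {..<n} {..<n}"
proof -
  have inj: "inj_on (\<lambda>i. (i + k) mod n) {..<n}"
  proof (rule inj_onI)
    fix i j assume "i \<in> {..<n}" "j \<in> {..<n}" "(i + k) mod n = (j + k) mod n"
    then show "i = j"
    proof (induction i j rule: linorder_wlog)
      case (le i j)
      then have "n dvd (j + k) - (i + k)"
        by (metis add_le_mono1 mod_eq_dvd_iff_nat)
      then show ?case
        using le by (auto dest!: dvd_imp_le)
    qed simp
  qed
  have "(\<lambda>i. (i + k) mod n) ` {..<n} = {..<n}"
    by (rule endo_inj_surj[OF _ _ inj]) (use assms in auto)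
  with inj show ?thesis
    by (simp add: bij_betw_def)
qed

text \<open>\<open>x i l\<close> is column \<open>l\<close> of block \<open>i\<close>, and block
  \<open>i\<close> has \<open>m i\<close> columns. The first columns of the blocks in each cyclic
  window of length \<open>d\<close> form a basis; this is what keeps the potential bounded
  below.\<close>

locale cyclically_independent =
  fixes d n :: nat and m :: "nat \<Rightarrow> nat" and x :: "nat \<Rightarrow> nat \<Rightarrow> nat \<Rightarrow> real"
  assumes d_pos: "0 < d" and n_pos: "0 < n" and m_pos: "\<And>i. i < n \<Longrightarrow> 0 < m i"
    and windows: "\<And>i. i < n \<Longrightarrow> fdet d (\<lambda>k. x ((i + k) mod n) 0) \<noteq> 0"
begin

text \<open>The squared Frobenius norm of \<open>A\<close> times block \<open>i\<close>.\<close>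

definition block_mass :: "(nat \<Rightarrow> nat \<Rightarrow> real) \<Rightarrow> nat \<Rightarrow> real" where
  "block_mass A i = (\<Sum>l<m i. \<Sum>j<d. (ip d (A j) (x i l))\<^sup>2)"

text \<open>The weight \<open>n / d\<close> makes the potential invariant under multiplication of
  \<open>A\<close> by a non-zero scalar, so only the shape of the scaling counts.\<close>

definition scaling_potential :: "(nat \<Rightarrow> nat \<Rightarrow> real) \<Rightarrow> real" where
  "scaling_potential A = (\<Sum>i<n. ln (block_mass A i)) - real n / real d * ln ((fdet d A)\<^sup>2)"

definition scaled :: "(nat \<Rightarrow> nat \<Rightarrow> real) \<Rightarrow> nat \<Rightarrow> nat \<Rightarrow> nat \<Rightarrow> real" where
  "scaled A i l j = sqrt (real d / real n) / sqrt (block_mass A i) * ip d (A j) (x i l)"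

section \<open>Positive block masses and a lower bound for the potential\<close>

lemma block_mass_nonneg: "0 \<le> block_mass A i"
  unfolding block_mass_def by (intro sum_nonneg) auto

text \<open>The images under \<open>A\<close> of the first columns in a window have determinant
  \<open>fdet d A\<close> times that of the window. The Hadamard-type bound applies to them, and
  each first column contributes at most the mass of its block.\<close>

lemma window_bound:
  assumes "i < n"
  shows "(fdet d (\<lambda>k. x ((i + k) mod n) 0) / fact d)\<^sup>2 * (fdet d A)\<^sup>2 \<le> (\<Prod>k<d. block_mass A ((i + k) mod n))"
proof -
  let ?s = "\<lambda>k. (i + k) mod n"
  let ?h = "\<lambda>k j. ip d (x (?s k) 0) (A j)"
  have "(fdet d (\<lambda>k. x (?s k) 0))\<^sup>2 * (fdet d A)\<^sup>2 = \<bar>fdet d ?h\<bar>\<^sup>2"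
    by (simp add: fdet_ip power_mult_distrib)
  also have "\<dots> \<le> (fact d * (\<Prod>k<d. sqrt (ip d (?h k) (?h k))))\<^sup>2"
    by (intro power_mono abs_fdet_le) auto
  also have "\<dots> = (fact d)\<^sup>2 * (\<Prod>k<d. ip d (?h k) (?h k))"
    by (simp add: power_mult_distrib prod_power_distrib ip_self_nonneg)
  also have "\<dots> \<le> (fact d)\<^sup>2 * (\<Prod>k<d. block_mass A (?s k))"
  proof (intro mult_left_mono prod_mono conjI ip_self_nonneg)
    fix k
    have "?s k < n"
      using n_pos by simp
    then have "(\<Sum>j<d. (ip d (A j) (x (?s k) 0))\<^sup>2) \<le> block_mass A (?s k)"
      unfolding block_mass_def using m_pos[of "?s k"] by (intro member_le_sum) (auto intro: sum_nonneg)
    then show "ip d (?h k) (?h k) \<le> block_mass A (?s k)"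
      by (simp add: ip_self ip_commute[of d "A _"])
  qed simp
  finally show ?thesis
    by (simp add: power_divide field_simps)
qed

lemma block_mass_pos:
  assumes "fdet d A \<noteq> 0" "i < n"
  shows "0 < block_mass A i"
proof -
  have "0 < (fdet d (\<lambda>k. x ((i + k) mod n) 0) / fact d)\<^sup>2 * (fdet d A)\<^sup>2"
    using assms windows[of i] by simp
  then have "(\<Prod>k<d. block_mass A ((i + k) mod n)) \<noteq> 0"
    using window_bound[OF assms(2), of A] by linarith
  then have "\<forall>k<d. block_mass A ((i + k) mod n) \<noteq> 0"
    by auto
  \<comment> \<open>Block \<open>i\<close> is the factor with \<open>k = 0\<close> of its own
    window.\<close>
  then have "block_mass A i \<noteq> 0"
    using d_pos assms(2) by (metis add_0_right mod_less)
  then show ?thesis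
    using block_mass_nonneg[of A i] by simp
qed

text \<open>The logarithms of the window bounds are summed over all \<open>n\<close> windows. For
  each of the \<open>d\<close> offsets the blocks are merely permuted, so each block mass is counted
  \<open>d\<close> times; division by \<open>d\<close> yields the weight
  \<open>n / d\<close>.\<close>

lemma scaling_potential_bounded_below:
  "\<exists>c. \<forall>A. fdet d A \<noteq> 0 \<longrightarrow> c \<le> scaling_potential A"
proof (intro exI allI impI)
  fix A assume A: "fdet d A \<noteq> 0"
  define \<delta> where "\<delta> i = (fdet d (\<lambda>k. x ((i + k) mod n) 0) / fact d)\<^sup>2" for i
  have \<delta>: "0 < \<delta> i" if "i < n" for i
    using windows[OF that] by (simp add: \<delta>_def)
  have Qp: "0 < block_mass A ((i + k) mod n)" for i k
    using block_mass_pos[OF A] n_pos by simp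
  have "(\<Sum>i<n. ln (\<delta> i)) + real n * ln ((fdet d A)\<^sup>2) = (\<Sum>i<n. ln (\<delta> i * (fdet d A)\<^sup>2))"
    using \<delta> A by (simp add: ln_mult_pos sum.distrib)
  also have "\<dots> \<le> (\<Sum>i<n. ln (\<Prod>k<d. block_mass A ((i + k) mod n)))"
    using \<delta> A Qp window_bound[of _ A] by (intro sum_mono ln_mono prod_pos) (auto simp: \<delta>_def)
  also have "\<dots> = (\<Sum>i<n. \<Sum>k<d. ln (block_mass A ((i + k) mod n)))"
    using Qp[THEN less_imp_neq, THEN not_sym] by (intro sum.cong refl ln_prod) auto
  also have "\<dots> = (\<Sum>k<d. \<Sum>i<n. ln (block_mass A ((i + k) mod n)))"
    by (rule sum.swap)
  also have "\<dots> = (\<Sum>k<d. \<Sum>i<n. ln (block_mass A i))"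
    by (intro sum.cong refl sum.reindex_bij_betw[OF bij_betw_add_mod[OF n_pos]])
  finally have "(\<Sum>i<n. ln (\<delta> i)) + real n * ln ((fdet d A)\<^sup>2) \<le> real d * (\<Sum>i<n. ln (block_mass A i))"
    by simp
  then show "(\<Sum>i<n. ln (\<delta> i)) / real d \<le> scaling_potential A"
    using d_pos by (simp add: scaling_potential_def field_simps)
qed

section \<open>Reduction to decreasing diagonal scalings\<close>

lemma scaling_potential_eqI:
  assumes "\<And>y. (\<Sum>j<d. (ip d (A j) y)\<^sup>2) = (\<Sum>j<d. (ip d (B j) y)\<^sup>2)"
    and "(fdet d A)\<^sup>2 = (fdet d B)\<^sup>2"
  shows "scaling_potential A = scaling_potential B"
  by (simp add: scaling_potential_def block_mass_def assms)

text \<open>The potential sees \<open>A\<close> only through its Gram matrix \<open>M\<close>, the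
  transpose of \<open>A\<close> times \<open>A\<close>. An orthonormal eigenbasis \<open>v\<close>
  of \<open>M\<close> and the singular values \<open>\<sigma>\<close> of \<open>A\<close> give a
  matrix with the same Gram matrix; it differs from \<open>A\<close> by an orthogonal factor on the
  left.\<close>

lemma diagonal_representative:
  assumes A: "fdet d A \<noteq> 0"
  obtains v \<sigma> where "orthonormal d v" "\<And>a. a < d \<Longrightarrow> 0 < \<sigma> a" "\<And>a b. a < b \<Longrightarrow> b < d \<Longrightarrow> \<sigma> b \<le> \<sigma> a"
    "fdet d (\<lambda>a p. \<sigma> a * v a p) \<noteq> 0"
    "scaling_potential (\<lambda>a p. \<sigma> a * v a p) = scaling_potential A"
proof -
  define M where "M p q = (\<Sum>j<d. A j p * A j q)" for p q
  obtain v where v: "orthonormal d v"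
    "\<And>a b. a < d \<Longrightarrow> b < d \<Longrightarrow> a \<noteq> b \<Longrightarrow> bform d M (v a) (v b) = 0"
    "\<And>a b. a < b \<Longrightarrow> b < d \<Longrightarrow> bform d M (v b) (v b) \<le> bform d M (v a) (v a)"
    using spectral_sorted[of d M] by (auto simp: M_def mult.commute)
  \<comment> \<open>\<open>h a\<close> is the image of the eigenvector \<open>v a\<close> under
    \<open>A\<close>; these images are pairwise orthogonal and their norms are the singular
    values.\<close>
  define h where "h a j = ip d (A j) (v a)" for a j
  have bform: "bform d M (v a) (v b) = ip d (h a) (h b)" for a b
    unfolding M_def bform_gram by (simp add: ip_def[of d "h a"] h_def)
  define \<sigma> where "\<sigma> a = sqrt (ip d (h a) (h a))" for a
  define B where "B a p = \<sigma> a * v a p" for a p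
  have \<sigma>2: "(\<sigma> a)\<^sup>2 = ip d (h a) (h a)" for a
    by (simp add: \<sigma>_def ip_self_nonneg)
  have ipB: "ip d (B a) y = \<sigma> a * ip d (v a) y" for a y
    by (simp add: B_def[abs_def] ip_scale_left)
  have "(fdet d h)\<^sup>2 = (\<Prod>a<d. (\<sigma> a)\<^sup>2)"
    unfolding \<sigma>2 using v(2) by (intro fdet_squared_orthogonal_rows) (simp add: bform)
  moreover have "fdet d h = fdet d A * fdet d v"
    using fdet_transpose[of d h] by (simp add: h_def[abs_def] fdet_ip)
  ultimately have detA: "(fdet d A)\<^sup>2 = (\<Prod>a<d. (\<sigma> a)\<^sup>2)"
    using orthonormal_fdet_squared[OF v(1)] by (simp add: power_mult_distrib)
  have orthB: "ip d (B a) (B b) = (if a = b then (\<sigma> a)\<^sup>2 else 0)" if "a < d" "b < d" for a b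
    using that v(1) by (simp add: ipB ip_commute[of d "v _" "B _"] orthonormal_ip power2_eq_square)
  then have detB: "(fdet d B)\<^sup>2 = (\<Prod>a<d. (\<sigma> a)\<^sup>2)"
    by (subst fdet_squared_orthogonal_rows) auto
  have sq: "(\<Sum>j<d. (ip d (A j) y)\<^sup>2) = (\<Sum>j<d. (ip d (B j) y)\<^sup>2)" for y
  proof -
    have "ip d (A j) y = (\<Sum>a<d. ip d (v a) y * h a j)" for j
      using parseval[OF v(1), of "A j" y] by (simp add: h_def ip_commute[of d "A j"] mult.commute)
    then have "(\<Sum>j<d. (ip d (A j) y)\<^sup>2)
        = ip d (\<lambda>j. \<Sum>a<d. ip d (v a) y * h a j) (\<lambda>j. \<Sum>a<d. ip d (v a) y * h a j)"
      by (simp add: ip_self)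
    also have "\<dots> = (\<Sum>a<d. (ip d (v a) y)\<^sup>2 * ip d (h a) (h a))"
      by (rule ip_orthogonal_combination) (use v(2) bform in simp)
    finally show ?thesis
      by (simp add: ipB \<sigma>2 power_mult_distrib mult.commute)
  qed
  show thesis
  proof
    show "orthonormal d v"
      by (rule v(1))
    show "0 < \<sigma> a" if "a < d" for a
    proof -
      have "(\<Prod>a<d. (\<sigma> a)\<^sup>2) \<noteq> 0"
        using A unfolding detA[symmetric] by simp
      then have "\<sigma> a \<noteq> 0"
        using that by auto
      then show ?thesis
        using ip_self_nonneg[of d "h a"] by (simp add: \<sigma>_def order_less_le)
    qed
    show "\<sigma> b \<le> \<sigma> a" if "a < b" "b < d" for a b
      using v(3)[OF that] by (simp add: \<sigma>_def bform)
    show "fdet d (\<lambda>a p. \<sigma> a * v a p) \<noteq> 0"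
      using A detA detB unfolding B_def[abs_def] by (metis power_eq_0_iff zero_power2)
    show "scaling_potential (\<lambda>a p. \<sigma> a * v a p) = scaling_potential A"
      using scaling_potential_eqI[of A B] sq detA detB by (simp add: B_def[abs_def])
  qed
qed

text \<open>Replacing \<open>A\<close> by \<open>(I + (sqrt (1 + t) - 1) e e\<^sup>T) U A\<close>, where \<open>e\<close> is the standard unit vector
  number \<open>a0\<close> and \<open>U\<close> has rows \<open>u\<close>.\<close>

lemma scaling_potential_step:
  assumes A: "fdet d A \<noteq> 0" and u: "orthonormal d u" and a0: "a0 < d" and t: "0 < t"
  shows "\<exists>A'. fdet d A' \<noteq> 0 \<and> scaling_potential A' \<le> scaling_potential A
    + real n / real d * (t * (\<Sum>i<n. \<Sum>l<m i. (ip d (u a0) (scaled A i l))\<^sup>2) - ln (1 + t))"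
proof -
  define \<beta> where "\<beta> k = (if k = a0 then sqrt (1 + t) else 1)" for k
  define C where "C k j = \<beta> k * u k j" for k j
  define A' where "A' k p = (\<Sum>j<d. C k j * A j p)" for k p
  define z where "z y j = ip d (A j) y" for y j
  \<comment> \<open>The part of the mass of the transformed block \<open>i\<close> that lies in the
    direction \<open>u a0\<close>. Stretching that direction by \<open>sqrt (1 + t)\<close> adds
    \<open>t * R i\<close> to the block mass and multiplies the squared determinant by
    \<open>1 + t\<close>.\<close>
  define R where "R i = (\<Sum>l<m i. (ip d (u a0) (z (x i l)))\<^sup>2)" for i
  have \<beta>2: "(\<beta> k)\<^sup>2 = (if k = a0 then 1 + t else 1)" for k
    using t by (simp add: \<beta>_def)
  have ipC: "ip d (C k) y = \<beta> k * ip d (u k) y" for k y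
    by (simp add: C_def[abs_def] ip_scale_left)
  have orthC: "ip d (C a) (C b) = (if a = b then (\<beta> a)\<^sup>2 else 0)" if "a < d" "b < d" for a b
    using that u by (simp add: ipC ip_commute[of d "u _" "C _"] orthonormal_ip power2_eq_square)
  then have "(fdet d C)\<^sup>2 = (\<Prod>k<d. (\<beta> k)\<^sup>2)"
    by (subst fdet_squared_orthogonal_rows) auto
  also have "\<dots> = 1 + t"
    unfolding \<beta>2 using a0 by simp
  finally have detC: "(fdet d C)\<^sup>2 = 1 + t" .
  have "fdet d A' = fdet d (\<lambda>k p. ip d (C k) (\<lambda>j. A j p))"
    by (simp add: A'_def[abs_def] ip_def)
  also have "\<dots> = fdet d C * fdet d A"
    unfolding fdet_ip by (simp only: fdet_transpose[of d A])
  finally have detA': "(fdet d A')\<^sup>2 = (1 + t) * (fdet d A)\<^sup>2"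
    by (simp add: power_mult_distrib detC)
  have ne: "fdet d A' \<noteq> 0"
    using detA' A t by auto
  have QA': "block_mass A' i = block_mass A i + t * R i" for i
  proof -
    have "(\<Sum>k<d. (ip d (A' k) y)\<^sup>2) = (\<Sum>j<d. (ip d (A j) y)\<^sup>2) + t * (ip d (u a0) (z y))\<^sup>2" for y
    proof -
      have ipA': "ip d (A' k) y = \<beta> k * ip d (u k) (z y)" for k
        unfolding ipC[symmetric] by (simp add: A'_def[abs_def] ip_sum_left ip_scale_left ip_def[of d "C k"] z_def)
      have "(\<Sum>k<d. (ip d (A' k) y)\<^sup>2)
          = (\<Sum>k<d. (ip d (u k) (z y))\<^sup>2 + (if k = a0 then t * (ip d (u a0) (z y))\<^sup>2 else 0))"
        by (intro sum.cong refl) (auto simp: ipA' power_mult_distrib \<beta>2 algebra_simps)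
      also have "\<dots> = ip d (z y) (z y) + t * (ip d (u a0) (z y))\<^sup>2"
        using a0 parseval[OF u, of "z y" "z y"] by (simp add: sum.distrib power2_eq_square)
      finally show ?thesis
        by (simp add: ip_self z_def)
    qed
    then show ?thesis
      by (simp add: block_mass_def R_def sum.distrib sum_distrib_left)
  qed
  have R: "0 \<le> R i" for i
    unfolding R_def by (intro sum_nonneg) auto
  \<comment> \<open>The bound \<open>ln (1 + y) \<le> y\<close> linearises the change, so that only
    the fraction of the mass along \<open>u a0\<close> enters.\<close>
  have lnQ: "ln (block_mass A' i) \<le> ln (block_mass A i) + t * (R i / block_mass A i)" if "i < n" for i
  proof -
    have q: "0 < block_mass A i"
      by (rule block_mass_pos[OF A that])
    have "0 \<le> t * (R i / block_mass A i)"
      using q t R by simp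
    then have "ln (1 + t * (R i / block_mass A i)) \<le> t * (R i / block_mass A i)"
      by (rule ln_add_one_self_le_self)
    moreover have "block_mass A' i = block_mass A i * (1 + t * (R i / block_mass A i))"
      using q by (simp add: QA' algebra_simps)
    then have "ln (block_mass A' i) = ln (block_mass A i) + ln (1 + t * (R i / block_mass A i))"
      using q \<open>0 \<le> t * (R i / block_mass A i)\<close> by (simp add: ln_mult_pos)
    ultimately show ?thesis
      by simp
  qed
  have RQ: "(\<Sum>l<m i. (ip d (u a0) (scaled A i l))\<^sup>2) = real d / real n * (R i / block_mass A i)" for i
  proof -
    have "ip d (u a0) (scaled A i l) = sqrt (real d / real n) / sqrt (block_mass A i) * ip d (u a0) (z (x i l))" for l
      unfolding ip_commute[of d "u a0"] scaled_def[abs_def] z_def[abs_def] by (rule ip_scale_left)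
    then show ?thesis
      using block_mass_nonneg[of A i]
      by (simp add: R_def power_mult_distrib power_divide sum_divide_distrib sum_distrib_left)
  qed
  have "(\<Sum>i<n. ln (block_mass A' i)) \<le> (\<Sum>i<n. ln (block_mass A i) + t * (R i / block_mass A i))"
    using lnQ by (intro sum_mono) simp
  also have "\<dots> = (\<Sum>i<n. ln (block_mass A i)) + t * (\<Sum>i<n. R i / block_mass A i)"
    by (simp add: sum.distrib sum_distrib_left)
  also have "(\<Sum>i<n. R i / block_mass A i) = real n / real d * (\<Sum>i<n. \<Sum>l<m i. (ip d (u a0) (scaled A i l))\<^sup>2)"
    unfolding RQ sum_distrib_left[symmetric] using d_pos n_pos by simp
  moreover have "ln ((fdet d A')\<^sup>2) = ln (1 + t) + ln ((fdet d A)\<^sup>2)"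
    unfolding detA' using t A by (simp add: ln_mult_pos)
  ultimately have "scaling_potential A' \<le> scaling_potential A
    + real n / real d * (t * (\<Sum>i<n. \<Sum>l<m i. (ip d (u a0) (scaled A i l))\<^sup>2) - ln (1 + t))"
    by (simp add: scaling_potential_def algebra_simps)
  with ne show ?thesis
    by blast
qed

end

section \<open>Distance to a diagonal rescaling\<close>

lemma bform_gram_blocks:
  fixes m :: "nat \<Rightarrow> nat"
  shows "bform d (\<lambda>p q. \<Sum>i<n. \<Sum>l<m i. w i l p * w i l q) x y
    = (\<Sum>i<n. \<Sum>l<m i. ip d (w i l) x * ip d (w i l) y)"
proof -
  have blocks: "(\<Sum>i<n. \<Sum>l<m i. f i l) = (\<Sum>c\<in>(SIGMA i:{..<n}. {..<m i}). f (fst c) (snd c))"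
    for f :: "nat \<Rightarrow> nat \<Rightarrow> real"
    by (subst sum.Sigma) (auto simp: case_prod_unfold)
  show ?thesis
    unfolding blocks by (rule bform_gram)
qed

text \<open>Change of basis for a bilinear form; it lets a form be identified from its values on one
  orthonormal basis.\<close>

lemma bform_orthonormal_expansion:
  assumes "orthonormal d u"
  shows "bform d M y z = (\<Sum>a<d. \<Sum>b<d. ip d (u a) y * ip d (u b) z * bform d M (u a) (u b))"
proof -
  have bform_ip: "bform d M y z = ip d y (\<lambda>i. ip d (M i) z)" for y z
    by (simp add: bform_def ip_def sum_distrib_left mult.assoc)
  have "ip d x (\<lambda>i. ip d (M i) z) = (\<Sum>b<d. ip d (u b) z * bform d M x (u b))" for x
  proof -
    have "ip d (M i) z = (\<Sum>b<d. ip d (u b) z * ip d (M i) (u b))" for i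
      using parseval[OF assms, of "M i" z] by (simp add: ip_commute[of d "M i"] mult.commute)
    then have "ip d x (\<lambda>i. ip d (M i) z) = ip d x (\<lambda>i. \<Sum>b<d. ip d (u b) z * ip d (M i) (u b))"
      by simp
    also have "\<dots> = (\<Sum>b<d. ip d (u b) z * bform d M x (u b))"
      by (simp add: bform_ip ip_commute[of d x] ip_sum_left ip_scale_left)
    finally show ?thesis .
  qed
  then show ?thesis
    unfolding bform_ip[of y z] parseval[OF assms, symmetric, of y]
    by (simp add: sum_distrib_left mult.assoc)
qed

text \<open>As the factors decrease, the changes are non-negative up to a threshold and non-positive
  after it. They sum to zero, so their total absolute value is twice the partial sum at the
  threshold, and every partial sum is non-negative.\<close>

lemma sum_abs_le_partial_sums:
  fixes p \<theta> :: "nat \<Rightarrow> real"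
  assumes p: "\<And>j. j < d \<Longrightarrow> 0 \<le> p j"
    and \<theta>: "\<And>a b. a < b \<Longrightarrow> b < d \<Longrightarrow> \<theta> b \<le> \<theta> a"
    and total: "(\<Sum>j<d. \<theta> j * p j - p j) = 0"
  shows "(\<Sum>j<d. \<bar>\<theta> j * p j - p j\<bar>) \<le> 2 * (\<Sum>k<d. \<Sum>j<k. \<theta> j * p j - p j)"
proof -
  define g where "g j = \<theta> j * p j - p j" for j
  have g: "g j = (\<theta> j - 1) * p j" for j
    by (simp add: g_def algebra_simps)
  define \<Delta> where "\<Delta> k = (\<Sum>j<k. g j)" for k
  \<comment> \<open>The first index whose factor is below 1; the value is \<open>d\<close> if there
    is none.\<close>
  define k0 where "k0 = (LEAST k. k = d \<or> \<theta> k < 1)"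
  have k0: "k0 = d \<or> \<theta> k0 < 1" "k0 \<le> d"
    unfolding k0_def by (rule LeastI[of _ d], simp, rule Least_le, simp)
  have pos: "0 \<le> g j" if "j < k0" for j
  proof -
    have "\<not> (j = d \<or> \<theta> j < 1)"
      using that unfolding k0_def by (rule not_less_Least)
    then show ?thesis
      using p[of j] that k0(2) by (simp add: g)
  qed
  have neg: "g j \<le> 0" if "k0 \<le> j" "j < d" for j
  proof -
    have "\<theta> j < 1"
      using k0 \<theta>[of k0 j] that by (cases "j = k0") auto
    then show ?thesis
      using p[of j] that by (simp add: g mult_nonpos_nonneg)
  qed
  have tail: "(\<Sum>j=k..<d. g j) = - \<Delta> k" if "k \<le> d" for k
    using total that sum.atLeastLessThan_concat[of 0 k d g]
    by (simp add: g_def[symmetric] \<Delta>_def atLeast0LessThan)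
  have \<Delta>: "0 \<le> \<Delta> k" if "k \<le> d" for k
  proof (cases "k \<le> k0")
    case True
    then show ?thesis
      unfolding \<Delta>_def by (intro sum_nonneg pos) auto
  next
    case False
    have "(\<Sum>j=k..<d. g j) \<le> 0"
      by (intro sum_nonpos neg) (use False in auto)
    then show ?thesis
      using tail[OF that] by simp
  qed
  have "(\<Sum>j<d. \<bar>g j\<bar>) = (\<Sum>j<k0. \<bar>g j\<bar>) + (\<Sum>j=k0..<d. \<bar>g j\<bar>)"
    using sum.atLeastLessThan_concat[of 0 k0 d "\<lambda>j. \<bar>g j\<bar>"] k0(2) by (simp add: atLeast0LessThan)
  also have "\<dots> = \<Delta> k0 + (\<Sum>j=k0..<d. - g j)"
    unfolding \<Delta>_def using pos neg by (intro arg_cong2[of _ _ _ _ "(+)"] sum.cong) auto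
  also have "\<dots> = 2 * \<Delta> k0"
    using tail[OF k0(2)] by (simp add: sum_negf)
  \<comment> \<open>The index \<open>d\<close> is outside the range of summation, but there the
    partial sum is the total, which is zero.\<close>
  also have "\<Delta> k0 \<le> (\<Sum>k<d. \<Delta> k)"
  proof (cases "k0 = d")
    case True
    then have "\<Delta> k0 = 0"
      using total by (simp add: \<Delta>_def g_def)
    moreover have "0 \<le> (\<Sum>k<d. \<Delta> k)"
      using \<Delta> by (intro sum_nonneg) auto
    ultimately show ?thesis
      by simp
  next
    case False
    then show ?thesis
      using k0(2) \<Delta> by (intro member_le_sum) auto
  qed
  finally show ?thesis
    by (simp add: g_def \<Delta>_def)
qed

text \<open>Since \<open>\<bar>c - 1\<bar> \<le> c + 1\<close>, the squared displacement caused by a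
  factor \<open>c\<close> is at most the change of mass it causes. This turns distance estimates
  into mass estimates.\<close>

lemma square_diff_one_le:
  fixes c :: real
  assumes "0 \<le> c"
  shows "(c - 1)\<^sup>2 \<le> \<bar>c\<^sup>2 - 1\<bar>"
proof -
  have "(c - 1)\<^sup>2 = \<bar>c - 1\<bar> * \<bar>c - 1\<bar>"
    by (simp add: power2_eq_square)
  also have "\<dots> \<le> \<bar>c - 1\<bar> * \<bar>c + 1\<bar>"
    using assms by (intro mult_left_mono) auto
  also have "\<dots> = \<bar>c\<^sup>2 - 1\<bar>"
    by (simp add: abs_mult[symmetric] power2_eq_square algebra_simps)
  finally show ?thesis .
qed

text \<open>From \<open>ln (1 + t) \<ge> t / (1 + t)\<close>. It certifies that a scaling step of
  size \<open>t\<close> strictly lowers the potential when the frame operator has the value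
  \<open>s\<close> in the chosen direction.\<close>

lemma mult_lt_ln_one_plus:
  fixes s t :: real
  assumes "0 < t" "s * (1 + t) < 1"
  shows "t * s < ln (1 + t)"
proof -
  have "s < 1 / (1 + t)"
    using assms by (simp add: field_simps)
  then have "t * s < t * (1 / (1 + t))"
    using assms(1) by (intro mult_strict_left_mono)
  also have "\<dots> = 1 - 1 / (1 + t)"
    using assms(1) by (simp add: field_simps)
  also have "\<dots> \<le> - ln (1 / (1 + t))"
    using ln_le_minus_one[of "1 / (1 + t)"] assms(1) by simp
  also have "\<dots> = ln (1 + t)"
    using assms(1) by (simp add: ln_div)
  finally show ?thesis .
qed

locale equal_norm_columns = cyclically_independent +
  fixes \<epsilon> :: real
  assumes norms: "\<And>i. i < n \<Longrightarrow> (\<Sum>l<m i. ip d (x i l) (x i l)) = real d / real n"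
    and lower: "\<And>u. ip d u u = 1 \<Longrightarrow> 1 - \<epsilon> \<le> (\<Sum>i<n. \<Sum>l<m i. (ip d u (x i l))\<^sup>2)"
begin

lemma scaled_norm:
  assumes "fdet d A \<noteq> 0" "i < n"
  shows "(\<Sum>l<m i. \<Sum>j<d. (scaled A i l j)\<^sup>2) = real d / real n"
proof -
  have "(\<Sum>l<m i. \<Sum>j<d. (scaled A i l j)\<^sup>2) = (real d / real n) / block_mass A i * block_mass A i"
    unfolding block_mass_def[of A i] sum_distrib_left
    using block_mass_nonneg[of A i] by (simp add: block_mass_def scaled_def power_mult_distrib power_divide)
  then show ?thesis
    using block_mass_pos[OF assms] by simp
qed

lemma scaled_abs_le:
  assumes "fdet d A \<noteq> 0" "i < n" "l < m i" "j < d"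
  shows "\<bar>scaled A i l j\<bar> \<le> sqrt (real d / real n)"
proof -
  have "(scaled A i l j)\<^sup>2 \<le> (\<Sum>j<d. (scaled A i l j)\<^sup>2)"
    using assms by (intro member_le_sum) auto
  also have "\<dots> \<le> (\<Sum>l<m i. \<Sum>j<d. (scaled A i l j)\<^sup>2)"
    using assms by (intro member_le_sum[of l "{..<m i}" "\<lambda>l. \<Sum>j<d. (scaled A i l j)\<^sup>2"]) (auto intro: sum_nonneg)
  finally show ?thesis
    using scaled_norm[OF assms(1,2)] by (intro real_le_rsqrt) simp
qed

text \<open>In the coordinates given by \<open>v\<close>, the scaling multiplies row
  \<open>j\<close> of block \<open>i\<close> by a factor that decreases in \<open>j\<close>, while
  the block norm is kept. The partial-sum estimate therefore applies to the row masses of each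
  block, and summation over the blocks brings in the frame operators.\<close>

lemma scaled_diagonal_dist:
  assumes v: "orthonormal d v" and \<sigma>: "\<And>a. a < d \<Longrightarrow> 0 < \<sigma> a"
    and mono: "\<And>a b. a < b \<Longrightarrow> b < d \<Longrightarrow> \<sigma> b \<le> \<sigma> a"
    and ne: "fdet d (\<lambda>a p. \<sigma> a * v a p) \<noteq> 0"
  defines "w \<equiv> scaled (\<lambda>a p. \<sigma> a * v a p)"
  shows "(\<Sum>i<n. \<Sum>l<m i. \<Sum>j<d. (w i l j - ip d (v j) (x i l))\<^sup>2)
    \<le> 2 * (\<Sum>k<d. \<Sum>j<k. (\<Sum>i<n. \<Sum>l<m i. (w i l j)\<^sup>2) - (1 - \<epsilon>))"
proof -
  define B where "B a p = \<sigma> a * v a p" for a p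
  \<comment> \<open>The mass of row \<open>j\<close> of block \<open>i\<close> before scaling;
    \<open>c i j\<close> is the factor by which the row is multiplied.\<close>
  define p where "p i j = (\<Sum>l<m i. (ip d (v j) (x i l))\<^sup>2)" for i j
  define c where "c i j = sqrt (real d / real n) / sqrt (block_mass B i) * \<sigma> j" for i j
  have w: "w i l j = c i j * ip d (v j) (x i l)" for i l j
    by (simp add: w_def scaled_def c_def B_def[abs_def] ip_scale_left)
  have c_nonneg: "0 \<le> c i j" if "j < d" for i j
    using \<sigma>[OF that] block_mass_nonneg[of B i] by (simp add: c_def)
  have w2: "(\<Sum>l<m i. (w i l j)\<^sup>2) = (c i j)\<^sup>2 * p i j" for i j
    by (simp add: w p_def power_mult_distrib sum_distrib_left)
  have block: "(\<Sum>l<m i. \<Sum>j<d. (w i l j - ip d (v j) (x i l))\<^sup>2)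
      \<le> 2 * (\<Sum>k<d. \<Sum>j<k. (c i j)\<^sup>2 * p i j - p i j)" if i: "i < n" for i
  proof -
    have "(\<Sum>l<m i. \<Sum>j<d. (w i l j - ip d (v j) (x i l))\<^sup>2) = (\<Sum>j<d. (c i j - 1)\<^sup>2 * p i j)"
    proof -
      have "(c i j * y - y)\<^sup>2 = (c i j - 1)\<^sup>2 * y\<^sup>2" for j y
        by (simp add: power2_eq_square algebra_simps)
      then show ?thesis
        by (subst sum.swap) (simp add: w p_def sum_distrib_left)
    qed
    also have "\<dots> \<le> (\<Sum>j<d. \<bar>(c i j)\<^sup>2 * p i j - p i j\<bar>)"
    proof (rule sum_mono)
      fix j assume j: "j \<in> {..<d}"
      have p: "0 \<le> p i j"
        unfolding p_def by (intro sum_nonneg) auto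
      have "(c i j - 1)\<^sup>2 * p i j \<le> \<bar>(c i j)\<^sup>2 - 1\<bar> * p i j"
        using square_diff_one_le[OF c_nonneg] j p by (intro mult_right_mono) auto
      also have "\<dots> = \<bar>((c i j)\<^sup>2 - 1) * p i j\<bar>"
        using p by (simp add: abs_mult)
      finally show "(c i j - 1)\<^sup>2 * p i j \<le> \<bar>(c i j)\<^sup>2 * p i j - p i j\<bar>"
        by (simp add: algebra_simps)
    qed
    also have "\<dots> \<le> 2 * (\<Sum>k<d. \<Sum>j<k. (c i j)\<^sup>2 * p i j - p i j)"
    proof (rule sum_abs_le_partial_sums)
      show "0 \<le> p i j" for j
        unfolding p_def by (intro sum_nonneg) auto
      show "(c i b)\<^sup>2 \<le> (c i a)\<^sup>2" if "a < b" "b < d" for a b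
        using mono[OF that] c_nonneg[OF that(2), of i] block_mass_nonneg[of B i]
        by (intro power_mono) (auto simp: c_def intro!: divide_right_mono mult_left_mono)
      have "(\<Sum>j<d. (c i j)\<^sup>2 * p i j) = (\<Sum>l<m i. \<Sum>j<d. (w i l j)\<^sup>2)"
        unfolding w2[symmetric] by (rule sum.swap)
      also have "\<dots> = (\<Sum>l<m i. ip d (x i l) (x i l))"
        unfolding w_def using scaled_norm[OF ne i] norms[OF i] by simp
      also have "\<dots> = (\<Sum>l<m i. \<Sum>j<d. (ip d (v j) (x i l))\<^sup>2)"
        using parseval[OF v] by (simp add: power2_eq_square)
      also have "\<dots> = (\<Sum>j<d. p i j)"
        unfolding p_def by (rule sum.swap)
      finally show "(\<Sum>j<d. (c i j)\<^sup>2 * p i j - p i j) = 0"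
        by (simp add: sum_subtractf)
    qed
    finally show ?thesis .
  qed
  have "(\<Sum>i<n. \<Sum>l<m i. \<Sum>j<d. (w i l j - ip d (v j) (x i l))\<^sup>2)
      \<le> (\<Sum>i<n. 2 * (\<Sum>k<d. \<Sum>j<k. (c i j)\<^sup>2 * p i j - p i j))"
    using block by (intro sum_mono) simp
  also have "\<dots> = 2 * (\<Sum>k<d. \<Sum>j<k. \<Sum>i<n. (c i j)\<^sup>2 * p i j - p i j)"
  proof -
    have "(\<Sum>i<n. \<Sum>k<d. \<Sum>j<k. (c i j)\<^sup>2 * p i j - p i j)
        = (\<Sum>k<d. \<Sum>i<n. \<Sum>j<k. (c i j)\<^sup>2 * p i j - p i j)"
      by (rule sum.swap)
    also have "\<dots> = (\<Sum>k<d. \<Sum>j<k. \<Sum>i<n. (c i j)\<^sup>2 * p i j - p i j)"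
      by (rule sum.cong[OF refl sum.swap])
    finally show ?thesis
      by (simp only: sum_distrib_left[symmetric])
  qed
  \<comment> \<open>Before scaling, row \<open>j\<close> has total mass at least
    \<open>1 - \<epsilon>\<close>: this is the lower frame bound at the unit vector
    \<open>v j\<close>.\<close>
  also have "\<dots> \<le> 2 * (\<Sum>k<d. \<Sum>j<k. (\<Sum>i<n. \<Sum>l<m i. (w i l j)\<^sup>2) - (1 - \<epsilon>))"
  proof (intro mult_left_mono sum_mono)
    fix k j assume "k \<in> {..<d}" "j \<in> {..<k}"
    then have "ip d (v j) (v j) = 1"
      using v by (simp add: orthonormal_ip)
    then have "1 - \<epsilon> \<le> (\<Sum>i<n. p i j)"
      unfolding p_def by (rule lower)
    then show "(\<Sum>i<n. (c i j)\<^sup>2 * p i j - p i j) \<le> (\<Sum>i<n. \<Sum>l<m i. (w i l j)\<^sup>2) - (1 - \<epsilon>)"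
      by (simp add: sum_subtractf w2)
  qed simp
  finally show ?thesis .
qed

end

section \<open>The limit of a minimising sequence\<close>

context equal_norm_columns
begin

lemma minimizing_sequence:
  obtains A s where "\<And>r. fdet d (A r) \<noteq> 0"
    "\<And>r::nat. scaling_potential (A r) < s + inverse (real (Suc r))"
    "\<And>C. fdet d C \<noteq> 0 \<Longrightarrow> s \<le> scaling_potential C"
proof -
  define P where "P = scaling_potential ` {A. fdet d A \<noteq> 0}"
  have bdd: "bdd_below P"
    using scaling_potential_bounded_below by (auto simp: P_def bdd_below_def)
  have "(fdet d (\<lambda>a j. if a = j then 1 else 0))\<^sup>2 = 1"
    by (rule orthonormal_fdet_squared[OF orthonormal_standard])
  then have "fdet d (\<lambda>a j. if a = j then 1 else 0) \<noteq> 0"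
    by auto
  then have ne: "P \<noteq> {}"
    unfolding P_def by blast
  have "\<exists>A. fdet d A \<noteq> 0 \<and> scaling_potential A < Inf P + inverse (real (Suc r))" for r
  proof -
    have "Inf P < Inf P + inverse (real (Suc r))"
      by simp
    then obtain y where "y \<in> P" "y < Inf P + inverse (real (Suc r))"
      using cInf_less_iff[OF ne bdd] by blast
    then show ?thesis
      unfolding P_def by blast
  qed
  then obtain A where "\<And>r. fdet d (A r) \<noteq> 0"
    "\<And>r. scaling_potential (A r) < Inf P + inverse (real (Suc r))"
    by metis
  moreover have "Inf P \<le> scaling_potential C" if "fdet d C \<noteq> 0" for C
    using that by (intro cInf_lower bdd) (auto simp: P_def)
  ultimately show thesis
    using that by blast
qed

text \<open>Nothing bounds the matrices \<open>B r\<close> along a minimising sequence. The rescaled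
  blocks and the rotations do have bounded entries, and one subsequence makes both converge.\<close>

lemma convergent_diagonal_sequence:
  obtains B :: "nat \<Rightarrow> nat \<Rightarrow> nat \<Rightarrow> real" and vs v w s where
    "\<And>r. fdet d (B r) \<noteq> 0" "(\<lambda>r. scaling_potential (B r)) \<longlonglongrightarrow> s"
    "\<And>C. fdet d C \<noteq> 0 \<Longrightarrow> s \<le> scaling_potential C"
    "\<And>r. orthonormal d (vs r)"
    "\<And>r. (\<Sum>i<n. \<Sum>l<m i. \<Sum>j<d. (scaled (B r) i l j - ip d (vs r j) (x i l))\<^sup>2)
      \<le> 2 * (\<Sum>k<d. \<Sum>j<k. (\<Sum>i<n. \<Sum>l<m i. (scaled (B r) i l j)\<^sup>2) - (1 - \<epsilon>))"
    "\<And>a j. a < d \<Longrightarrow> j < d \<Longrightarrow> (\<lambda>r. vs r a j) \<longlonglongrightarrow> v a j"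
    "\<And>i l j. i < n \<Longrightarrow> l < m i \<Longrightarrow> j < d \<Longrightarrow> (\<lambda>r. scaled (B r) i l j) \<longlonglongrightarrow> w i l j"
proof -
  obtain A s where A: "\<And>r. fdet d (A r) \<noteq> 0"
    "\<And>r::nat. scaling_potential (A r) < s + inverse (real (Suc r))"
    "\<And>C. fdet d C \<noteq> 0 \<Longrightarrow> s \<le> scaling_potential C"
    by (rule minimizing_sequence) (rule that)
  define good where "good r v B \<longleftrightarrow>
    orthonormal d v \<and> fdet d B \<noteq> 0 \<and> scaling_potential B = scaling_potential (A r) \<and>
    (\<Sum>i<n. \<Sum>l<m i. \<Sum>j<d. (scaled B i l j - ip d (v j) (x i l))\<^sup>2)
      \<le> 2 * (\<Sum>k<d. \<Sum>j<k. (\<Sum>i<n. \<Sum>l<m i. (scaled B i l j)\<^sup>2) - (1 - \<epsilon>))" for r v B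
  have "\<exists>v B. good r v B" for r
  proof -
    obtain v \<sigma> where v: "orthonormal d v" "\<And>a. a < d \<Longrightarrow> 0 < \<sigma> a"
      "\<And>a b. a < b \<Longrightarrow> b < d \<Longrightarrow> \<sigma> b \<le> \<sigma> a" "fdet d (\<lambda>a p. \<sigma> a * v a p) \<noteq> 0"
      "scaling_potential (\<lambda>a p. \<sigma> a * v a p) = scaling_potential (A r)"
      by (rule diagonal_representative[OF A(1)[of r]]) (rule that)
    have "good r v (\<lambda>a p. \<sigma> a * v a p)"
      unfolding good_def by (intro conjI v(1,4,5) scaled_diagonal_dist[OF v(1-4)])
    then show ?thesis
      by blast
  qed
  then obtain V B where "\<And>r. good r (V r) (B r)"
    by metis
  then have VB: "\<And>r. orthonormal d (V r)" "\<And>r. fdet d (B r) \<noteq> 0"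
    "\<And>r. scaling_potential (B r) = scaling_potential (A r)"
    "\<And>r. (\<Sum>i<n. \<Sum>l<m i. \<Sum>j<d. (scaled (B r) i l j - ip d (V r j) (x i l))\<^sup>2)
      \<le> 2 * (\<Sum>k<d. \<Sum>j<k. (\<Sum>i<n. \<Sum>l<m i. (scaled (B r) i l j)\<^sup>2) - (1 - \<epsilon>))"
    by (simp_all add: good_def)
  \<comment> \<open>A disjoint union indexes the entries of the rotations and of the rescaled blocks
    together, so that a single extraction serves both.\<close>
  define K :: "(nat \<times> nat + nat \<times> nat \<times> nat) set"
    where "K = Inl ` ({..<d} \<times> {..<d}) \<union> Inr ` (SIGMA i:{..<n}. {..<m i} \<times> {..<d})"
  define f where "f r k = (case k of Inl (a, j) \<Rightarrow> V r a j | Inr (i, l, j) \<Rightarrow> scaled (B r) i l j)"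
    for r and k :: "nat \<times> nat + nat \<times> nat \<times> nat"
  have "\<bar>f r k\<bar> \<le> 1 + sqrt (real d / real n)" if "k \<in> K" for r k
  proof -
    have "\<bar>f r k\<bar> \<le> 1 \<or> \<bar>f r k\<bar> \<le> sqrt (real d / real n)"
      using that orthonormal_entry_le[OF VB(1)] scaled_abs_le[OF VB(2)]
      by (auto simp: K_def f_def)
    moreover have "0 \<le> sqrt (real d / real n)"
      by simp
    ultimately show ?thesis
      by linarith
  qed
  moreover have "finite K"
    by (auto simp: K_def)
  ultimately obtain g L where g: "strict_mono g" "\<forall>k\<in>K. (\<lambda>r. f (g r) k) \<longlonglongrightarrow> L k"
    using pointwise_convergent_subseq[of K f] by blast
  show thesis
  proof (rule that[where B = "\<lambda>r. B (g r)" and vs = "\<lambda>r. V (g r)"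
        and v = "\<lambda>a j. L (Inl (a, j))" and w = "\<lambda>i l j. L (Inr (i, l, j))"])
    have "(\<lambda>r. s + inverse (real (Suc (g r)))) \<longlonglongrightarrow> s + 0"
      using LIMSEQ_subseq_LIMSEQ[OF LIMSEQ_inverse_real_of_nat g(1)]
      by (intro tendsto_intros) (simp add: o_def)
    then have lim: "(\<lambda>r. s + inverse (real (Suc (g r)))) \<longlonglongrightarrow> s"
      by simp
    show "(\<lambda>r. scaling_potential (B (g r))) \<longlonglongrightarrow> s"
      by (rule tendsto_sandwich[OF _ _ tendsto_const lim])
        (use A VB in \<open>auto intro!: always_eventually less_imp_le\<close>)
    show "(\<lambda>r. V (g r) a j) \<longlonglongrightarrow> L (Inl (a, j))" if "a < d" "j < d" for a j
      using bspec[OF g(2), of "Inl (a, j)"] that by (simp add: K_def f_def)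
    show "(\<lambda>r. scaled (B (g r)) i l j) \<longlonglongrightarrow> L (Inr (i, l, j))" if "i < n" "l < m i" "j < d" for i l j
    proof -
      have "Inr (i, l, j) \<in> K"
        using that by (auto simp: K_def)
      from bspec[OF g(2) this] show ?thesis
        by (simp add: f_def)
    qed
  qed (use A(3) VB in auto)
qed

text \<open>If the limit frame operator has an eigenvalue below 1, then
  \<open>scaling_potential_step\<close> along that eigenvector beats the infimum \<open>s\<close>; as its trace is \<open>d\<close>, it is
  the identity.\<close>

lemma limit_parseval:
  assumes B: "\<And>r. fdet d (B r) \<noteq> 0" "(\<lambda>r::nat. scaling_potential (B r)) \<longlonglongrightarrow> s"
    and s: "\<And>C. fdet d C \<noteq> 0 \<Longrightarrow> s \<le> scaling_potential C"
    and w: "\<And>i l j. i < n \<Longrightarrow> l < m i \<Longrightarrow> j < d \<Longrightarrow> (\<lambda>r. scaled (B r) i l j) \<longlonglongrightarrow> w i l j"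
    and norm_w: "\<And>i. i < n \<Longrightarrow> (\<Sum>l<m i. ip d (w i l) (w i l)) = real d / real n"
  shows "(\<Sum>i<n. \<Sum>l<m i. ip d (w i l) y * ip d (w i l) z) = ip d y z"
proof -
  define S where "S p q = (\<Sum>i<n. \<Sum>l<m i. w i l p * w i l q)" for p q
  have S: "bform d S y z = (\<Sum>i<n. \<Sum>l<m i. ip d (w i l) y * ip d (w i l) z)" for y z
    unfolding S_def by (rule bform_gram_blocks)
  obtain u where u: "orthonormal d u"
    "\<And>a b. a < d \<Longrightarrow> b < d \<Longrightarrow> a \<noteq> b \<Longrightarrow> bform d S (u a) (u b) = 0"
    using spectral_sorted[of d S] by (auto simp: S_def mult.commute)
  have ge: "1 \<le> bform d S (u a) (u a)" if a: "a < d" for a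
  proof (rule ccontr)
    define e where "e = bform d S (u a) (u a)"
    assume "\<not> 1 \<le> bform d S (u a) (u a)"
    then have e1: "e < 1"
      by (simp add: e_def)
    have e0: "0 \<le> e"
      unfolding e_def S by (intro sum_nonneg) simp
    \<comment> \<open>This choice gives \<open>e * t \<le> t < 1 - e\<close>, hence
      \<open>e * (1 + t) < 1\<close>.\<close>
    define t where "t = (1 - e) / 2"
    have t: "0 < t"
      using e1 by (simp add: t_def)
    have "e * (1 + t) < 1"
    proof -
      have "e * t \<le> 1 * t"
        using e1 t by (intro mult_right_mono) auto
      also have "\<dots> < 1 - e"
        using e1 by (simp add: t_def)
      finally show ?thesis
        by (simp add: algebra_simps)
    qed
    then have lt: "t * e < ln (1 + t)"
      by (rule mult_lt_ln_one_plus[OF t])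
    define e' where "e' r = (\<Sum>i<n. \<Sum>l<m i. (ip d (u a) (scaled (B r) i l))\<^sup>2)" for r
    have "(\<lambda>r. e' r) \<longlonglongrightarrow> (\<Sum>i<n. \<Sum>l<m i. (ip d (u a) (w i l))\<^sup>2)"
      unfolding e'_def ip_def by (intro tendsto_intros w) auto
    then have "(\<lambda>r. e' r) \<longlonglongrightarrow> e"
      by (simp add: e_def S power2_eq_square ip_commute[of d "u a"])
    then have "(\<lambda>r. scaling_potential (B r) + real n / real d * (t * e' r - ln (1 + t)))
        \<longlonglongrightarrow> s + real n / real d * (t * e - ln (1 + t))"
      by (intro tendsto_intros B(2))
    moreover have "s \<le> scaling_potential (B r) + real n / real d * (t * e' r - ln (1 + t))" for r
      using scaling_potential_step[OF B(1) u(1) a t, of r] s unfolding e'_def by fastforce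
    ultimately have "s \<le> s + real n / real d * (t * e - ln (1 + t))"
      using LIMSEQ_le_const by blast
    then have "0 \<le> real n / real d * (t * e - ln (1 + t))"
      by simp
    moreover have "0 < real n / real d"
      using n_pos d_pos by simp
    ultimately show False
      using lt mult_pos_neg[of "real n / real d" "t * e - ln (1 + t)"] by linarith
  qed
  \<comment> \<open>The trace in the basis \<open>u\<close> is the sum of the \<open>n\<close> block
    norms \<open>d / n\<close>. Diagonal values that are all at least 1 and sum to \<open>d\<close>
    must equal 1.\<close>
  have "(\<Sum>a<d. bform d S (u a) (u a)) = (\<Sum>a<d. \<Sum>i<n. \<Sum>l<m i. ip d (u a) (w i l) * ip d (u a) (w i l))"
    by (simp add: S ip_commute[of d "u _"])
  also have "\<dots> = (\<Sum>i<n. \<Sum>a<d. \<Sum>l<m i. ip d (u a) (w i l) * ip d (u a) (w i l))"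
    by (rule sum.swap)
  also have "\<dots> = (\<Sum>i<n. \<Sum>l<m i. \<Sum>a<d. ip d (u a) (w i l) * ip d (u a) (w i l))"
    by (rule sum.cong[OF refl sum.swap])
  also have "\<dots> = real d"
    using norm_w n_pos by (simp add: parseval[OF u(1)])
  finally have "(\<Sum>a<d. bform d S (u a) (u a) - 1) = 0"
    by (simp add: sum_subtractf)
  then have "\<forall>a\<in>{..<d}. bform d S (u a) (u a) - 1 = 0"
    using ge by (subst (asm) sum_nonneg_eq_0_iff) auto
  then have diag: "bform d S (u a) (u b) = (if a = b then 1 else 0)" if "a < d" "b < d" for a b
    using u(2) that by auto
  have "bform d S y z = (\<Sum>a<d. \<Sum>b<d. if a = b then ip d (u a) y * ip d (u a) z else 0)"
    by (subst bform_orthonormal_expansion[OF u(1)], intro sum.cong refl) (auto simp: diag)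
  also have "\<dots> = ip d y z"
    using parseval[OF u(1)] by simp
  finally show ?thesis
    unfolding S .
qed

text \<open>The distance bound for the scaled blocks passes to the limit, where every row mass is 1.
  The limit lives in the coordinates given by the limit rotation \<open>v\<close>, and rotating back
  produces the required columns.\<close>

theorem exists_near_parseval:
  "\<exists>W. (\<forall>i<n. (\<Sum>l<m i. ip d (W i l) (W i l)) = real d / real n) \<and>
    (\<forall>p<d. \<forall>q<d. (\<Sum>i<n. \<Sum>l<m i. W i l p * W i l q) = (if p = q then 1 else 0)) \<and>
    (\<Sum>i<n. \<Sum>l<m i. \<Sum>p<d. (x i l p - W i l p)\<^sup>2) \<le> real d * (real d - 1) * \<epsilon>"
proof -
  obtain B :: "nat \<Rightarrow> nat \<Rightarrow> nat \<Rightarrow> real" and vs v w s where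
    B: "\<And>r. fdet d (B r) \<noteq> 0" "(\<lambda>r. scaling_potential (B r)) \<longlonglongrightarrow> s"
    "\<And>C. fdet d C \<noteq> 0 \<Longrightarrow> s \<le> scaling_potential C" and
    vs: "\<And>r. orthonormal d (vs r)" and
    dist: "\<And>r. (\<Sum>i<n. \<Sum>l<m i. \<Sum>j<d. (scaled (B r) i l j - ip d (vs r j) (x i l))\<^sup>2)
      \<le> 2 * (\<Sum>k<d. \<Sum>j<k. (\<Sum>i<n. \<Sum>l<m i. (scaled (B r) i l j)\<^sup>2) - (1 - \<epsilon>))" and
    lim_v: "\<And>a j. a < d \<Longrightarrow> j < d \<Longrightarrow> (\<lambda>r. vs r a j) \<longlonglongrightarrow> v a j" and
    lim_w: "\<And>i l j. i < n \<Longrightarrow> l < m i \<Longrightarrow> j < d \<Longrightarrow> (\<lambda>r. scaled (B r) i l j) \<longlonglongrightarrow> w i l j"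
    by (rule convergent_diagonal_sequence) (rule that)
  have v: "orthonormal d v"
    by (rule orthonormal_limit[OF vs lim_v])
  have norm_w: "(\<Sum>l<m i. ip d (w i l) (w i l)) = real d / real n" if "i < n" for i
  proof -
    have "(\<lambda>r. \<Sum>l<m i. \<Sum>j<d. (scaled (B r) i l j)\<^sup>2) \<longlonglongrightarrow> (\<Sum>l<m i. \<Sum>j<d. (w i l j)\<^sup>2)"
      using that by (intro tendsto_intros lim_w) auto
    then have "(\<lambda>r::nat. real d / real n) \<longlonglongrightarrow> (\<Sum>l<m i. \<Sum>j<d. (w i l j)\<^sup>2)"
      unfolding scaled_norm[OF B(1) that] .
    then show ?thesis
      unfolding ip_self by (rule LIMSEQ_unique[OF _ tendsto_const])
  qed
  have frame_w: "(\<Sum>i<n. \<Sum>l<m i. ip d (w i l) y * ip d (w i l) z) = ip d y z" for y z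
    by (rule limit_parseval[OF B lim_w norm_w])
  have diag_w: "(\<Sum>i<n. \<Sum>l<m i. (w i l j)\<^sup>2) = 1" if "j < d" for j
  proof -
    define e where "e k = (if k = j then 1 else 0 :: real)" for k
    have "ip d y e = y j" for y
      using that by (simp add: ip_def e_def if_distrib[of "\<lambda>x. _ * x"] cong: if_cong)
    then show ?thesis
      using frame_w[of e e] by (simp add: power2_eq_square e_def)
  qed
  have "(\<lambda>r. \<Sum>i<n. \<Sum>l<m i. \<Sum>j<d. (scaled (B r) i l j - ip d (vs r j) (x i l))\<^sup>2)
      \<longlonglongrightarrow> (\<Sum>i<n. \<Sum>l<m i. \<Sum>j<d. (w i l j - ip d (v j) (x i l))\<^sup>2)"
    unfolding ip_def by (intro tendsto_intros lim_w lim_v) auto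
  moreover have "(\<lambda>r. 2 * (\<Sum>k<d. \<Sum>j<k. (\<Sum>i<n. \<Sum>l<m i. (scaled (B r) i l j)\<^sup>2) - (1 - \<epsilon>)))
      \<longlonglongrightarrow> 2 * (\<Sum>k<d. \<Sum>j<k. (\<Sum>i<n. \<Sum>l<m i. (w i l j)\<^sup>2) - (1 - \<epsilon>))"
    by (intro tendsto_intros lim_w) auto
  ultimately have "(\<Sum>i<n. \<Sum>l<m i. \<Sum>j<d. (w i l j - ip d (v j) (x i l))\<^sup>2)
      \<le> 2 * (\<Sum>k<d. \<Sum>j<k. (\<Sum>i<n. \<Sum>l<m i. (w i l j)\<^sup>2) - (1 - \<epsilon>))"
    by (rule LIMSEQ_le) (use dist in auto)
  \<comment> \<open>Each inner sum has \<open>k\<close> terms, all equal to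
    \<open>1 - (1 - \<epsilon>)\<close>.\<close>
  also have "\<dots> = 2 * (\<Sum>k<d. real k * \<epsilon>)"
    by (intro arg_cong[of _ _ "(*) 2"] sum.cong refl) (simp add: diag_w)
  also have "\<dots> = real d * (real d - 1) * \<epsilon>"
    by (induction d) (auto simp: algebra_simps)
  finally have dist_w: "(\<Sum>i<n. \<Sum>l<m i. \<Sum>j<d. (w i l j - ip d (v j) (x i l))\<^sup>2) \<le> real d * (real d - 1) * \<epsilon>" .
  \<comment> \<open>The transpose of the orthogonal matrix \<open>v\<close> carries the limit back
    to the original coordinates, preserving norms, frame identity and distances.\<close>
  define W where "W i l p = (\<Sum>j<d. w i l j * v j p)" for i l p
  have W_eq: "W i l = (\<lambda>p. \<Sum>j<d. w i l j * v j p)" for i l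
    by (simp add: W_def fun_eq_iff)
  have W_norm: "(\<Sum>l<m i. ip d (W i l) (W i l)) = real d / real n" if "i < n" for i
    unfolding W_eq parseval_synthesis[OF v] by (rule norm_w[OF that])
  have W_frame: "(\<Sum>i<n. \<Sum>l<m i. W i l p * W i l q) = (if p = q then 1 else 0)" if "p < d" "q < d" for p q
    using frame_w[of "\<lambda>j. v j p" "\<lambda>j. v j q"] orthonormal_ip[OF orthonormal_transpose[OF v] that]
    by (simp add: W_def ip_def[of d "w _ _"])
  have W_dist: "(\<Sum>p<d. (x i l p - W i l p)\<^sup>2) = (\<Sum>j<d. (w i l j - ip d (v j) (x i l))\<^sup>2)" for i l
  proof -
    have ip_W: "ip d (v j) (W i l) = w i l j" if "j < d" for j
    proof -
      have "ip d (v j) (W i l) = (\<Sum>a<d. w i l a * ip d (v a) (v j))"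
        unfolding W_eq by (subst ip_commute) (simp add: ip_sum_left ip_scale_left)
      also have "\<dots> = (\<Sum>a<d. if a = j then w i l j else 0)"
        using that by (intro sum.cong refl) (auto simp: orthonormal_ip[OF v])
      finally show ?thesis
        using that by simp
    qed
    have ip_diff: "ip d (v j) (\<lambda>p. x i l p - W i l p) = ip d (v j) (x i l) - ip d (v j) (W i l)" for j
      by (simp add: ip_def sum_subtractf algebra_simps)
    have "(\<Sum>j<d. (w i l j - ip d (v j) (x i l))\<^sup>2)
        = (\<Sum>j<d. ip d (v j) (\<lambda>p. x i l p - W i l p) * ip d (v j) (\<lambda>p. x i l p - W i l p))"
      by (intro sum.cong refl) (simp add: ip_diff ip_W power2_eq_square algebra_simps)
    also have "\<dots> = ip d (\<lambda>p. x i l p - W i l p) (\<lambda>p. x i l p - W i l p)"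
      by (rule parseval[OF v])
    finally show ?thesis
      by (simp add: ip_self)
  qed
  show ?thesis
  proof (intro exI[of _ W] conjI allI impI)
    show "(\<Sum>i<n. \<Sum>l<m i. \<Sum>p<d. (x i l p - W i l p)\<^sup>2) \<le> real d * (real d - 1) * \<epsilon>"
      using dist_w by (simp only: W_dist)
  qed (simp_all add: W_norm W_frame)
qed

end

section \<open>Perturbation and normalisation\<close>

lemma bform_diff: "bform d (\<lambda>p q. M p q - N p q) x y = bform d M x y - bform d N x y"
  by (simp add: bform_def sum_subtractf algebra_simps)

lemma fdet_scale_rows: "fdet d (\<lambda>k j. c k * a k j) = (\<Prod>k<d. c k) * fdet d a"
proof -
  let ?D = "\<lambda>i k. if k = i then c i else 0"
  have "fdet d (\<lambda>k j. c k * a k j) = fdet d (\<lambda>i k. ip d (?D i) (\<lambda>j. a j k))"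
    by (intro fdet_cong) (simp add: ip_def if_distrib[of "\<lambda>x. x * _"] cong: if_cong)
  also have "\<dots> = (\<Prod>k<d. c k) * fdet d a"
    unfolding fdet_ip fdet_transpose[of d a] by (subst fdet_diagonal) auto
  finally show ?thesis .
qed

text \<open>On unit vectors a quadratic form is at most the sum of the absolute values of its matrix
  entries; this is applied to the difference of the two frame operators.\<close>

lemma frame_lower_perturb:
  fixes m :: "nat \<Rightarrow> nat"
  assumes u: "ip d u u = 1"
    and close: "(\<Sum>p<d. \<Sum>q<d. \<bar>(\<Sum>i<n. \<Sum>l<m i. y i l p * y i l q) - (\<Sum>i<n. \<Sum>l<m i. x i l p * x i l q)\<bar>) \<le> \<delta>"
  shows "(\<Sum>i<n. \<Sum>l<m i. (ip d u (x i l))\<^sup>2) - \<delta> \<le> (\<Sum>i<n. \<Sum>l<m i. (ip d u (y i l))\<^sup>2)"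
proof -
  define S where "S w p q = (\<Sum>i<n. \<Sum>l<m i. w i l p * w i l q)"
    for w :: "nat \<Rightarrow> nat \<Rightarrow> nat \<Rightarrow> real" and p q
  have S: "bform d (S w) u u = (\<Sum>i<n. \<Sum>l<m i. (ip d u (w i l))\<^sup>2)" for w
    unfolding S_def bform_gram_blocks by (simp add: ip_commute[of d u] power2_eq_square)
  have "\<bar>bform d (\<lambda>p q. S y p q - S x p q) u u\<bar> \<le> \<delta>"
    by (rule order.trans[OF bform_unit_le[OF u]]) (use close in \<open>simp add: S_def\<close>)
  then show ?thesis
    unfolding bform_diff S by linarith
qed

lemma generic_perturbation:
  fixes m :: "nat \<Rightarrow> nat" and x :: "nat \<Rightarrow> nat \<Rightarrow> nat \<Rightarrow> real"
  assumes d: "d \<le> n" and n: "0 < n" and \<delta>: "0 < \<delta>"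
  shows "\<exists>y. (\<forall>i<n. fdet d (\<lambda>k. y ((i + k) mod n) 0) \<noteq> 0) \<and>
    (\<forall>i<n. \<bar>(\<Sum>l<m i. ip d (y i l) (y i l)) - (\<Sum>l<m i. ip d (x i l) (x i l))\<bar> \<le> \<delta>) \<and>
    (\<Sum>p<d. \<Sum>q<d. \<bar>(\<Sum>i<n. \<Sum>l<m i. y i l p * y i l q) - (\<Sum>i<n. \<Sum>l<m i. x i l p * x i l q)\<bar>) \<le> \<delta> \<and>
    (\<Sum>i<n. \<Sum>l<m i. \<Sum>j<d. (x i l j - y i l j)\<^sup>2) \<le> \<delta>"
proof -
  \<comment> \<open>The first column of block \<open>i\<close> is moved along the Vandermonde vector
    with node \<open>Suc i\<close>. Within a window the nodes are distinct because
    \<open>d \<le> n\<close>, so only finitely many \<open>t\<close> leave some window singular; the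
    other requirements hold for small \<open>t\<close> by continuity.\<close>
  define e where "e i l j = (if l = 0 then real (Suc i) ^ j else 0)" for i l j :: nat
  define y where "y t i l j = x i l j + t * e i l j" for t i l j
  define bad where "bad i = {t. fdet d (\<lambda>k. y t ((i + k) mod n) 0) = 0}" for i
  have lim: "((\<lambda>t. y t i l j) \<longlongrightarrow> x i l j) (at_right 0)" for i l j
  proof -
    have "((\<lambda>t. y t i l j) \<longlongrightarrow> x i l j + 0 * e i l j) (at_right 0)"
      unfolding y_def by (intro tendsto_intros)
    then show ?thesis
      by simp
  qed
  have "finite (bad i)" for i
  proof -
    have "inj_on (\<lambda>k. (i + k) mod n) {..<n}"
      using bij_betw_add_mod[OF n, of i] by (simp add: bij_betw_def add.commute)
    then have "inj_on (\<lambda>k. (i + k) mod n) {..<d}"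
      by (rule inj_on_subset) (use d in auto)
    then have "inj_on (\<lambda>k. real (Suc ((i + k) mod n))) {..<d}"
      by (simp add: inj_on_def)
    from fdet_vandermonde_nonzero[OF this] show ?thesis
      unfolding bad_def y_def e_def if_P[OF refl] by (rule finite_singular_pencil)
  qed
  then have "\<forall>\<^sub>F t in at_right 0. \<forall>s\<in>(\<Union>i<n. bad i). t \<noteq> s"
    by (intro eventually_ball_finite ballI eventually_neq_at_within) auto
  moreover have "\<forall>\<^sub>F t in at_right 0. \<forall>i\<in>{..<n}.
      \<bar>(\<Sum>l<m i. ip d (y t i l) (y t i l)) - (\<Sum>l<m i. ip d (x i l) (x i l))\<bar> < \<delta>"
  proof (intro eventually_ball_finite ballI)
    fix i
    have "((\<lambda>t. \<bar>(\<Sum>l<m i. ip d (y t i l) (y t i l)) - (\<Sum>l<m i. ip d (x i l) (x i l))\<bar>)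
        \<longlongrightarrow> \<bar>(\<Sum>l<m i. ip d (x i l) (x i l)) - (\<Sum>l<m i. ip d (x i l) (x i l))\<bar>) (at_right 0)"
      unfolding ip_def by (intro tendsto_intros lim)
    then show "\<forall>\<^sub>F t in at_right 0.
        \<bar>(\<Sum>l<m i. ip d (y t i l) (y t i l)) - (\<Sum>l<m i. ip d (x i l) (x i l))\<bar> < \<delta>"
      by (rule order_tendstoD(2)) (use \<delta> in simp)
  qed simp
  moreover have "\<forall>\<^sub>F t in at_right 0. (\<Sum>p<d. \<Sum>q<d.
      \<bar>(\<Sum>i<n. \<Sum>l<m i. y t i l p * y t i l q) - (\<Sum>i<n. \<Sum>l<m i. x i l p * x i l q)\<bar>) < \<delta>"
  proof -
    have "((\<lambda>t. \<Sum>p<d. \<Sum>q<d.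
        \<bar>(\<Sum>i<n. \<Sum>l<m i. y t i l p * y t i l q) - (\<Sum>i<n. \<Sum>l<m i. x i l p * x i l q)\<bar>)
      \<longlongrightarrow> (\<Sum>p<d. \<Sum>q<d.
        \<bar>(\<Sum>i<n. \<Sum>l<m i. x i l p * x i l q) - (\<Sum>i<n. \<Sum>l<m i. x i l p * x i l q)\<bar>)) (at_right 0)"
      by (intro tendsto_intros lim)
    then show ?thesis
      by (rule order_tendstoD(2)) (use \<delta> in simp)
  qed
  moreover have "\<forall>\<^sub>F t in at_right 0. (\<Sum>i<n. \<Sum>l<m i. \<Sum>j<d. (x i l j - y t i l j)\<^sup>2) < \<delta>"
  proof -
    have "((\<lambda>t. \<Sum>i<n. \<Sum>l<m i. \<Sum>j<d. (x i l j - y t i l j)\<^sup>2)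
      \<longlongrightarrow> (\<Sum>i<n. \<Sum>l<m i. \<Sum>j<d. (x i l j - x i l j)\<^sup>2)) (at_right 0)"
      by (intro tendsto_intros lim)
    then show ?thesis
      by (rule order_tendstoD(2)) (use \<delta> in simp)
  qed
  ultimately have "\<forall>\<^sub>F t in at_right 0. (\<forall>s\<in>(\<Union>i<n. bad i). t \<noteq> s) \<and>
    (\<forall>i\<in>{..<n}. \<bar>(\<Sum>l<m i. ip d (y t i l) (y t i l)) - (\<Sum>l<m i. ip d (x i l) (x i l))\<bar> < \<delta>) \<and>
    (\<Sum>p<d. \<Sum>q<d. \<bar>(\<Sum>i<n. \<Sum>l<m i. y t i l p * y t i l q) - (\<Sum>i<n. \<Sum>l<m i. x i l p * x i l q)\<bar>) < \<delta> \<and>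
    (\<Sum>i<n. \<Sum>l<m i. \<Sum>j<d. (x i l j - y t i l j)\<^sup>2) < \<delta>"
    by (intro eventually_conj)
  from eventually_happens'[OF _ this] obtain t where t: "\<forall>s\<in>(\<Union>i<n. bad i). t \<noteq> s"
    "\<forall>i\<in>{..<n}. \<bar>(\<Sum>l<m i. ip d (y t i l) (y t i l)) - (\<Sum>l<m i. ip d (x i l) (x i l))\<bar> < \<delta>"
    "(\<Sum>p<d. \<Sum>q<d. \<bar>(\<Sum>i<n. \<Sum>l<m i. y t i l p * y t i l q) - (\<Sum>i<n. \<Sum>l<m i. x i l p * x i l q)\<bar>) < \<delta>"
    "(\<Sum>i<n. \<Sum>l<m i. \<Sum>j<d. (x i l j - y t i l j)\<^sup>2) < \<delta>"
    by auto
  have "\<forall>i<n. fdet d (\<lambda>k. y t ((i + k) mod n) 0) \<noteq> 0"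
    using t(1) by (auto simp: bad_def)
  with t(2-4) show ?thesis
    by (intro exI[of _ "y t"] conjI) (auto intro: less_imp_le)
qed

lemma normalisation:
  fixes m :: "nat \<Rightarrow> nat" and y :: "nat \<Rightarrow> nat \<Rightarrow> nat \<Rightarrow> real"
  assumes c: "0 < c" and \<epsilon>: "0 < \<epsilon>" "\<epsilon> < 1"
    and windows: "\<And>i. i < n \<Longrightarrow> fdet d (\<lambda>k. y ((i + k) mod n) 0) \<noteq> 0"
    and norms: "\<And>i. i < n \<Longrightarrow> (1 - \<epsilon>) * c \<le> (\<Sum>l<m i. ip d (y i l) (y i l))"
      "\<And>i. i < n \<Longrightarrow> (\<Sum>l<m i. ip d (y i l) (y i l)) \<le> (1 + \<epsilon>) * c"
    and lower: "\<And>u. ip d u u = 1 \<Longrightarrow> 1 - \<epsilon> \<le> (\<Sum>i<n. \<Sum>l<m i. (ip d u (y i l))\<^sup>2)"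
  shows "\<exists>z. (\<forall>i<n. fdet d (\<lambda>k. z ((i + k) mod n) 0) \<noteq> 0) \<and>
    (\<forall>i<n. (\<Sum>l<m i. ip d (z i l) (z i l)) = c) \<and>
    (\<forall>u. ip d u u = 1 \<longrightarrow> 1 - 2 * \<epsilon> \<le> (\<Sum>i<n. \<Sum>l<m i. (ip d u (z i l))\<^sup>2)) \<and>
    (\<Sum>i<n. \<Sum>l<m i. \<Sum>j<d. (y i l j - z i l j)\<^sup>2) \<le> real n * (\<epsilon> * c)"
proof -
  define N where "N i = (\<Sum>l<m i. ip d (y i l) (y i l))" for i
  \<comment> \<open>The factor that brings block \<open>i\<close> to squared norm exactly
    \<open>c\<close>.\<close>
  define \<kappa> where "\<kappa> i = sqrt (c / N i)" for i
  define z where "z i l j = \<kappa> i * y i l j" for i l j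
  have N: "0 < N i" if "i < n" for i
  proof -
    have "0 < (1 - \<epsilon>) * c"
      using c \<epsilon> by simp
    then show ?thesis
      using norms(1)[OF that] by (simp add: N_def)
  qed
  have \<kappa>2: "(\<kappa> i)\<^sup>2 = c / N i" if "i < n" for i
    using N[OF that] c by (simp add: \<kappa>_def)
  have \<kappa>: "0 < \<kappa> i" if "i < n" for i
    using N[OF that] c by (simp add: \<kappa>_def)
  have "fdet d (\<lambda>k. z ((i + k) mod n) 0) \<noteq> 0" if "i < n" for i
  proof -
    have "0 < \<kappa> ((i + k) mod n)" for k
      using that by (intro \<kappa>) simp
    then have "(\<Prod>k<d. \<kappa> ((i + k) mod n)) \<noteq> 0"
      by (simp add: less_imp_neq[THEN not_sym])
    then show ?thesis
      using windows[OF that] unfolding z_def fdet_scale_rows by simp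
  qed
  moreover have "(\<Sum>l<m i. ip d (z i l) (z i l)) = c" if "i < n" for i
  proof -
    have "ip d (z i l) (z i l) = (\<kappa> i)\<^sup>2 * ip d (y i l) (y i l)" for l
      by (simp add: ip_self z_def power_mult_distrib sum_distrib_left)
    then have "(\<Sum>l<m i. ip d (z i l) (z i l)) = (\<kappa> i)\<^sup>2 * N i"
      by (simp add: N_def sum_distrib_left)
    then show ?thesis
      using \<kappa>2[OF that] N[OF that] by simp
  qed
  moreover have "1 - 2 * \<epsilon> \<le> (\<Sum>i<n. \<Sum>l<m i. (ip d u (z i l))\<^sup>2)" if u: "ip d u u = 1" for u
  proof -
    \<comment> \<open>Each squared factor is at least \<open>1 / (1 + \<epsilon>)\<close>, and
      \<open>(1 - 2 * \<epsilon>) * (1 + \<epsilon>) \<le> 1 - \<epsilon>\<close>.\<close>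
    have "1 - 2 * \<epsilon> \<le> 1 / (1 + \<epsilon>) * (1 - \<epsilon>)"
      using \<epsilon> by (simp add: field_simps)
    also have "\<dots> \<le> 1 / (1 + \<epsilon>) * (\<Sum>i<n. \<Sum>l<m i. (ip d u (y i l))\<^sup>2)"
      using lower[OF u] \<epsilon> by (intro mult_left_mono) auto
    also have "\<dots> = (\<Sum>i<n. 1 / (1 + \<epsilon>) * (\<Sum>l<m i. (ip d u (y i l))\<^sup>2))"
      by (rule sum_distrib_left)
    also have "\<dots> \<le> (\<Sum>i<n. (\<kappa> i)\<^sup>2 * (\<Sum>l<m i. (ip d u (y i l))\<^sup>2))"
    proof (intro sum_mono mult_right_mono sum_nonneg)
      fix i assume "i \<in> {..<n}"
      then show "1 / (1 + \<epsilon>) \<le> (\<kappa> i)\<^sup>2"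
        using N[of i] norms(2)[of i] c \<epsilon> by (simp add: \<kappa>2 N_def[symmetric] field_simps)
    qed simp
    also have "\<dots> = (\<Sum>i<n. \<Sum>l<m i. (ip d u (z i l))\<^sup>2)"
    proof -
      have "ip d u (z i l) = \<kappa> i * ip d u (y i l)" for i l
        by (simp add: ip_def z_def sum_distrib_left algebra_simps)
      then show ?thesis
        by (simp add: power_mult_distrib sum_distrib_left)
    qed
    finally show ?thesis .
  qed
  moreover have "(\<Sum>i<n. \<Sum>l<m i. \<Sum>j<d. (y i l j - z i l j)\<^sup>2) \<le> (\<Sum>i<n. \<epsilon> * c)"
  proof (rule sum_mono)
    fix i assume "i \<in> {..<n}"
    then have i: "i < n"
      by simp
    have "(y i l j - z i l j)\<^sup>2 = (\<kappa> i - 1)\<^sup>2 * (y i l j)\<^sup>2" for l j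
      by (simp add: z_def power2_eq_square algebra_simps)
    then have "(\<Sum>l<m i. \<Sum>j<d. (y i l j - z i l j)\<^sup>2) = (\<kappa> i - 1)\<^sup>2 * N i"
      by (simp add: N_def ip_self sum_distrib_left)
    also have "\<dots> \<le> \<bar>(\<kappa> i)\<^sup>2 - 1\<bar> * N i"
      using square_diff_one_le[of "\<kappa> i"] \<kappa>[OF i] N[OF i] by (intro mult_right_mono) auto
    also have "\<dots> = \<bar>((\<kappa> i)\<^sup>2 - 1) * N i\<bar>"
      using N[OF i] by (simp add: abs_mult)
    also have "\<dots> = \<bar>c - N i\<bar>"
      using \<kappa>2[OF i] N[OF i] by (simp add: field_simps)
    also have "\<dots> \<le> \<epsilon> * c"
      using norms[OF i] by (simp add: N_def[symmetric] abs_le_iff algebra_simps)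
    finally show "(\<Sum>l<m i. \<Sum>j<d. (y i l j - z i l j)\<^sup>2) \<le> \<epsilon> * c" .
  qed
  ultimately show ?thesis
    by (intro exI[of _ z] conjI) auto
qed

lemma paulsen_columns:
  fixes m :: "nat \<Rightarrow> nat" and x :: "nat \<Rightarrow> nat \<Rightarrow> nat \<Rightarrow> real"
  assumes d: "0 < d" "d \<le> n" and m: "\<And>i. i < n \<Longrightarrow> 0 < m i" and \<epsilon>: "0 < \<epsilon>" "\<epsilon> < 1 / 2"
    and norms: "\<And>i. i < n \<Longrightarrow> (1 - \<epsilon>) * (real d / real n) \<le> (\<Sum>l<m i. ip d (x i l) (x i l))"
      "\<And>i. i < n \<Longrightarrow> (\<Sum>l<m i. ip d (x i l) (x i l)) \<le> (1 + \<epsilon>) * (real d / real n)"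
    and lower: "\<And>u. ip d u u = 1 \<Longrightarrow> 1 - \<epsilon> \<le> (\<Sum>i<n. \<Sum>l<m i. (ip d u (x i l))\<^sup>2)"
  shows "\<exists>W. (\<forall>i<n. (\<Sum>l<m i. ip d (W i l) (W i l)) = real d / real n) \<and>
    (\<forall>p<d. \<forall>q<d. (\<Sum>i<n. \<Sum>l<m i. W i l p * W i l q) = (if p = q then 1 else 0)) \<and>
    (\<Sum>i<n. \<Sum>l<m i. \<Sum>p<d. (x i l p - W i l p)\<^sup>2) \<le> 21 * \<epsilon> * (real d)\<^sup>2"
proof -
  have n: "0 < n"
    using d by simp
  define c where "c = real d / real n"
  \<comment> \<open>Small compared with the block norm \<open>c\<close>, so the relative norm error
    only doubles; as \<open>c \<le> 1\<close>, also at most \<open>\<epsilon>\<close>, which serves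
    the frame bound and the distance.\<close>
  define \<delta> where "\<delta> = \<epsilon> * c"
  have c: "0 < c" "c \<le> 1"
    using d n by (simp_all add: c_def)
  have \<delta>: "0 < \<delta>" "\<delta> \<le> \<epsilon>"
    using c \<epsilon> by (simp_all add: \<delta>_def)
  obtain y where y: "\<forall>i<n. fdet d (\<lambda>k. y ((i + k) mod n) 0) \<noteq> 0"
    "\<forall>i<n. \<bar>(\<Sum>l<m i. ip d (y i l) (y i l)) - (\<Sum>l<m i. ip d (x i l) (x i l))\<bar> \<le> \<delta>"
    "(\<Sum>p<d. \<Sum>q<d. \<bar>(\<Sum>i<n. \<Sum>l<m i. y i l p * y i l q) - (\<Sum>i<n. \<Sum>l<m i. x i l p * x i l q)\<bar>) \<le> \<delta>"
    "(\<Sum>i<n. \<Sum>l<m i. \<Sum>j<d. (x i l j - y i l j)\<^sup>2) \<le> \<delta>"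
    using generic_perturbation[OF d(2) n \<delta>(1), of m x] by blast
  have norms_y: "(1 - 2 * \<epsilon>) * c \<le> (\<Sum>l<m i. ip d (y i l) (y i l))"
    "(\<Sum>l<m i. ip d (y i l) (y i l)) \<le> (1 + 2 * \<epsilon>) * c" if "i < n" for i
    using norms[OF that] y(2)[rule_format, OF that]
    unfolding c_def[symmetric] \<delta>_def abs_le_iff by (auto simp: algebra_simps)
  have lower_y: "1 - 2 * \<epsilon> \<le> (\<Sum>i<n. \<Sum>l<m i. (ip d u (y i l))\<^sup>2)" if "ip d u u = 1" for u
    using lower[OF that] frame_lower_perturb[OF that y(3)] \<delta>(2) by linarith
  obtain z where z: "\<forall>i<n. fdet d (\<lambda>k. z ((i + k) mod n) 0) \<noteq> 0"
    "\<forall>i<n. (\<Sum>l<m i. ip d (z i l) (z i l)) = c"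
    "\<forall>u. ip d u u = 1 \<longrightarrow> 1 - 2 * (2 * \<epsilon>) \<le> (\<Sum>i<n. \<Sum>l<m i. (ip d u (z i l))\<^sup>2)"
    "(\<Sum>i<n. \<Sum>l<m i. \<Sum>j<d. (y i l j - z i l j)\<^sup>2) \<le> real n * (2 * \<epsilon> * c)"
    using normalisation[of c "2 * \<epsilon>" n d y m] c \<epsilon> y(1) norms_y lower_y by auto
  interpret equal_norm_columns d n m z "4 * \<epsilon>"
    using d(1) n m z by unfold_locales (auto simp: c_def)
  obtain W where W: "\<forall>i<n. (\<Sum>l<m i. ip d (W i l) (W i l)) = real d / real n"
    "\<forall>p<d. \<forall>q<d. (\<Sum>i<n. \<Sum>l<m i. W i l p * W i l q) = (if p = q then 1 else 0)"
    "(\<Sum>i<n. \<Sum>l<m i. \<Sum>p<d. (z i l p - W i l p)\<^sup>2) \<le> real d * (real d - 1) * (4 * \<epsilon>)"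
    using exists_near_parseval by blast
  \<comment> \<open>Three successive displacements are combined: perturbation, normalisation and
    scaling. Their squared lengths are at most \<open>\<epsilon>\<close>,
    \<open>2 * \<epsilon> * d\<close> and \<open>4 * \<epsilon> * d * (d - 1)\<close>.\<close>
  have three: "(a - e)\<^sup>2 \<le> 3 * ((a - b)\<^sup>2 + (b - c)\<^sup>2 + (c - e)\<^sup>2)" for a b c e :: real
  proof -
    have "0 \<le> ((a - b) - (b - c))\<^sup>2 + ((b - c) - (c - e))\<^sup>2 + ((a - b) - (c - e))\<^sup>2"
      by simp
    then show ?thesis
      by (simp add: power2_eq_square algebra_simps)
  qed
  have "(\<Sum>i<n. \<Sum>l<m i. \<Sum>p<d. (x i l p - W i l p)\<^sup>2) \<le> (\<Sum>i<n. \<Sum>l<m i. \<Sum>p<d.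
      3 * ((x i l p - y i l p)\<^sup>2 + (y i l p - z i l p)\<^sup>2 + (z i l p - W i l p)\<^sup>2))"
    by (intro sum_mono three)
  also have "\<dots> = 3 * ((\<Sum>i<n. \<Sum>l<m i. \<Sum>p<d. (x i l p - y i l p)\<^sup>2)
      + (\<Sum>i<n. \<Sum>l<m i. \<Sum>p<d. (y i l p - z i l p)\<^sup>2)
      + (\<Sum>i<n. \<Sum>l<m i. \<Sum>p<d. (z i l p - W i l p)\<^sup>2))"
    by (simp only: sum_distrib_left[symmetric] sum.distrib)
  also have "\<dots> \<le> 3 * (\<epsilon> + 2 * \<epsilon> * real d + real d * (real d - 1) * (4 * \<epsilon>))"
  proof -
    have "2 * \<epsilon> * real d = real n * (2 * \<epsilon> * c)"
      using n by (simp add: c_def)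
    with z(4) have "(\<Sum>i<n. \<Sum>l<m i. \<Sum>j<d. (y i l j - z i l j)\<^sup>2) \<le> 2 * \<epsilon> * real d"
      by (simp only:)
    then show ?thesis
      using y(4) W(3) \<delta>(2) by (intro mult_left_mono add_mono) auto
  qed
  also have "\<dots> = \<epsilon> * (3 - 6 * real d + 12 * (real d)\<^sup>2)"
    by (simp add: power2_eq_square algebra_simps)
  also have "\<dots> \<le> \<epsilon> * (21 * (real d)\<^sup>2)"
  proof (intro mult_left_mono)
    have "1 \<le> real d" "1 \<le> (real d)\<^sup>2"
      using d(1) by simp_all
    then show "3 - 6 * real d + 12 * (real d)\<^sup>2 \<le> 21 * (real d)\<^sup>2"
      by linarith
  qed (use \<epsilon> in simp)
  finally show ?thesis
    using W(1,2) by (intro exI[of _ W] conjI) (auto simp: algebra_simps)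
qed

section \<open>Matrix frames\<close>

lemma frob_norm_squared_columns:
  assumes "A \<in> carrier_mat d k"
  shows "(frob_norm A)\<^sup>2 = (\<Sum>l<k. ip d (\<lambda>j. A $$ (j, l)) (\<lambda>j. A $$ (j, l)))"
proof -
  have "(frob_norm A)\<^sup>2 = (\<Sum>j<d. \<Sum>l<k. (A $$ (j, l))\<^sup>2)"
    using assms by (simp add: frob_norm_def sum_nonneg)
  also have "\<dots> = (\<Sum>l<k. \<Sum>j<d. (A $$ (j, l))\<^sup>2)"
    by (rule sum.swap)
  finally show ?thesis
    by (simp add: ip_self)
qed

lemma frame_operator_entry:
  assumes "mat_tuple d n m X" "p < d" "q < d"
  shows "frame_operator d n X $$ (p, q) = (\<Sum>i<n. \<Sum>l<m (Suc i). X (Suc i) $$ (p, l) * X (Suc i) $$ (q, l))"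
proof -
  have "frame_operator d n X $$ (p, q) = (\<Sum>i<n. (X (Suc i) * transpose_mat (X (Suc i))) $$ (p, q))"
    using assms(2,3) by (simp add: frame_operator_def sum.atLeast1_atMost_eq)
  also have "\<dots> = (\<Sum>i<n. \<Sum>l<m (Suc i). X (Suc i) $$ (p, l) * X (Suc i) $$ (q, l))"
  proof (rule sum.cong[OF refl])
    fix i assume "i \<in> {..<n}"
    then have "X (Suc i) \<in> carrier_mat d (m (Suc i))"
      using assms(1) by (simp add: mat_tuple_def)
    then show "(X (Suc i) * transpose_mat (X (Suc i))) $$ (p, q)
        = (\<Sum>l<m (Suc i). X (Suc i) $$ (p, l) * X (Suc i) $$ (q, l))"
      using assms(2,3) by (simp add: scalar_prod_def atLeast0LessThan)
  qed
  finally show ?thesis .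
qed

lemma loewner_scalar_le_bform:
  assumes "loewner_le d (c \<cdot>\<^sub>m 1\<^sub>m d) A"
  shows "c * ip d u u \<le> bform d (\<lambda>p q. A $$ (p, q)) u u"
proof -
  have A: "A \<in> carrier_mat d d"
    and psd: "0 \<le> vec d u \<bullet> ((A - c \<cdot>\<^sub>m 1\<^sub>m d) *\<^sub>v vec d u)"
    using assms by (auto simp: loewner_le_def symmetric_mat_def pos_semidef_mat_def)
  have "vec d u \<bullet> ((A - c \<cdot>\<^sub>m 1\<^sub>m d) *\<^sub>v vec d u)
      = bform d (\<lambda>p q. A $$ (p, q) - (if p = q then c else 0)) u u"
    using A by (simp add: scalar_prod_def bform_def atLeast0LessThan sum_distrib_left mult.assoc
        if_distrib[of "\<lambda>x. c * x"] cong: if_cong)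
  also have "\<dots> = bform d (\<lambda>p q. A $$ (p, q)) u u - bform d (\<lambda>p q. if p = q then c else 0) u u"
    by (rule bform_diff)
  also have "bform d (\<lambda>p q. if p = q then c else 0) u u = c * ip d u u"
    by (simp add: bform_def ip_def sum_distrib_left if_distrib[of "\<lambda>x. _ * x"] if_distrib[of "\<lambda>x. x * _"]
        algebra_simps cong: if_cong)
  finally show ?thesis
    using psd by simp
qed

theorem theorem2:
  fixes d n :: nat and m :: "nat \<Rightarrow> nat" and \<epsilon> :: real and X :: "nat \<Rightarrow> real mat"
  assumes "0 < d" and "0 < n" and "\<And>i. i \<in> {1..n} \<Longrightarrow> 0 < m i" and "d < n"
    and "0 < \<epsilon>" and "\<epsilon> < 0.3"
    and "nearly_equal_norm_parseval_frame \<epsilon> d n m X"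
  shows "\<exists>W. equal_norm_parseval_frame d n m W \<and>
    frame_dist_sq n X W \<le> 46 * \<epsilon> * (real d)\<^sup>2"
proof -
  have X: "mat_tuple d n m X" "loewner_le d ((1 - \<epsilon>) \<cdot>\<^sub>m 1\<^sub>m d) (frame_operator d n X)"
    "\<And>k. k \<in> {1..n} \<Longrightarrow> (1 - \<epsilon>) * (real d / real n) \<le> (frob_norm (X k))\<^sup>2"
    "\<And>k. k \<in> {1..n} \<Longrightarrow> (frob_norm (X k))\<^sup>2 \<le> (1 + \<epsilon>) * (real d / real n)"
    using assms(7) by (auto simp: nearly_equal_norm_parseval_frame_def)
  have carrier: "X (Suc i) \<in> carrier_mat d (m (Suc i))" if "i < n" for i
    using X(1) that by (simp add: mat_tuple_def)
  \<comment> \<open>The matrices are numbered from 1 and the blocks from 0, hence the shift by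
    \<open>Suc\<close>; \<open>x i l\<close> is column \<open>l\<close> of matrix
    \<open>Suc i\<close>.\<close>
  define x where "x i l j = X (Suc i) $$ (j, l)" for i l j
  have norm_x: "(frob_norm (X (Suc i)))\<^sup>2 = (\<Sum>l<m (Suc i). ip d (x i l) (x i l))" if "i < n" for i
    using frob_norm_squared_columns[OF carrier[OF that]] by (simp add: x_def[abs_def])
  have lower: "1 - \<epsilon> \<le> (\<Sum>i<n. \<Sum>l<m (Suc i). (ip d u (x i l))\<^sup>2)" if "ip d u u = 1" for u
  proof -
    have "1 - \<epsilon> \<le> bform d (\<lambda>p q. frame_operator d n X $$ (p, q)) u u"
      using loewner_scalar_le_bform[OF X(2), of u] that by simp
    also have "\<dots> = bform d (\<lambda>p q. \<Sum>i<n. \<Sum>l<m (Suc i). x i l p * x i l q) u u"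
      unfolding bform_def x_def using frame_operator_entry[OF X(1)] by simp
    also have "\<dots> = (\<Sum>i<n. \<Sum>l<m (Suc i). (ip d u (x i l))\<^sup>2)"
      unfolding bform_gram_blocks by (simp add: ip_commute[of d u] power2_eq_square)
    finally show ?thesis .
  qed
  have "\<exists>W. (\<forall>i<n. (\<Sum>l<m (Suc i). ip d (W i l) (W i l)) = real d / real n) \<and>
    (\<forall>p<d. \<forall>q<d. (\<Sum>i<n. \<Sum>l<m (Suc i). W i l p * W i l q) = (if p = q then 1 else 0)) \<and>
    (\<Sum>i<n. \<Sum>l<m (Suc i). \<Sum>p<d. (x i l p - W i l p)\<^sup>2) \<le> 21 * \<epsilon> * (real d)\<^sup>2"
  proof (rule paulsen_columns)
    show "(1 - \<epsilon>) * (real d / real n) \<le> (\<Sum>l<m (Suc i). ip d (x i l) (x i l))"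
      "(\<Sum>l<m (Suc i). ip d (x i l) (x i l)) \<le> (1 + \<epsilon>) * (real d / real n)" if "i < n" for i
      using X(3,4)[of "Suc i"] that norm_x[OF that] by simp_all
  qed (use assms lower in auto)
  then obtain W where W: "\<And>i. i < n \<Longrightarrow> (\<Sum>l<m (Suc i). ip d (W i l) (W i l)) = real d / real n"
    "\<And>p q. p < d \<Longrightarrow> q < d \<Longrightarrow> (\<Sum>i<n. \<Sum>l<m (Suc i). W i l p * W i l q) = (if p = q then 1 else 0)"
    "(\<Sum>i<n. \<Sum>l<m (Suc i). \<Sum>p<d. (x i l p - W i l p)\<^sup>2) \<le> 21 * \<epsilon> * (real d)\<^sup>2"
    by blast
  \<comment> \<open>The columns are reassembled into matrices, undoing the index shift.\<close>
  define Y where "Y k = mat d (m k) (\<lambda>(p, l). W (k - 1) l p)" for k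
  have Y: "mat_tuple d n m Y"
    by (simp add: mat_tuple_def Y_def)
  have "frame_operator d n Y = 1\<^sub>m d"
  proof (rule eq_matI)
    fix p q assume "p < dim_row (1\<^sub>m d :: real mat)" "q < dim_col (1\<^sub>m d :: real mat)"
    then show "frame_operator d n Y $$ (p, q) = 1\<^sub>m d $$ (p, q)"
      using frame_operator_entry[OF Y, of p q] W(2)[of p q] by (simp add: Y_def)
  qed (simp_all add: frame_operator_def)
  moreover have "(frob_norm (Y k))\<^sup>2 = real d / real n" if k: "k \<in> {1..n}" for k
  proof -
    obtain i where i: "k = Suc i" "i < n"
      using k by (cases k) auto
    have "(frob_norm (Y k))\<^sup>2 = (\<Sum>l<m k. ip d (\<lambda>j. Y k $$ (j, l)) (\<lambda>j. Y k $$ (j, l)))"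
      by (rule frob_norm_squared_columns) (simp add: Y_def)
    also have "\<dots> = (\<Sum>l<m (Suc i). ip d (W i l) (W i l))"
      by (intro sum.cong) (auto simp: i Y_def ip_def)
    finally show ?thesis
      using W(1)[OF i(2)] by simp
  qed
  moreover have "frame_dist_sq n X Y \<le> 46 * \<epsilon> * (real d)\<^sup>2"
  proof -
    have "frame_dist_sq n X Y = (\<Sum>i<n. (frob_norm (X (Suc i) - Y (Suc i)))\<^sup>2)"
      by (simp add: frame_dist_sq_def sum.atLeast1_atMost_eq)
    also have "\<dots> = (\<Sum>i<n. \<Sum>l<m (Suc i). \<Sum>p<d. (x i l p - W i l p)\<^sup>2)"
    proof (rule sum.cong[OF refl])
      fix i assume "i \<in> {..<n}"
      then have "X (Suc i) - Y (Suc i) \<in> carrier_mat d (m (Suc i))"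
        unfolding Y_def by (intro minus_carrier_mat) simp
      from frob_norm_squared_columns[OF this]
      show "(frob_norm (X (Suc i) - Y (Suc i)))\<^sup>2 = (\<Sum>l<m (Suc i). \<Sum>p<d. (x i l p - W i l p)\<^sup>2)"
        by (simp add: ip_self x_def Y_def)
    qed
    also have "\<dots> \<le> 46 * \<epsilon> * (real d)\<^sup>2"
    proof -
      have "21 * \<epsilon> * (real d)\<^sup>2 \<le> 46 * \<epsilon> * (real d)\<^sup>2"
        using assms(5) by (intro mult_right_mono) auto
      with W(3) show ?thesis
        by linarith
    qed
    finally show ?thesis .
  qed
  ultimately show ?thesis
    using Y by (auto simp: equal_norm_parseval_frame_def)
qed

end
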